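(* Let $a_1,a_2:\mathbf R^3\to\mathbf R^3$ be continuously differentiable and suppose there are $c_1,c_2,c_3>0$ such that for $i=1,2$ and all $x,y\in\mathbf R^3$: $(a_i(x)-a_i(y))\cdot(x-y)\ge c_1|x-y|^2$, $|a_i(x)-a_i(y)|\le c_2|x-y|$, $|\partial a_i(x)-\partial a_i(y)|\le c_3|x-y|$. Assume moreover that $a_i(Ry)=R\,a_i(y)$ for $i=1,2$, all orthogonal $R\in\mathbf R^{3\times3}$ and all $y\in\mathbf R^3$, and that $\omega=B_1(0)$ is the unit ball of $\mathbf R^3$. For $U_0,P_0\in\mathbf R^3$ define $$\begin{aligned}dJ(\Omega)(U_0,P_0):={}&(a_1(U_0)-a_2(U_0))\cdot P_0\\&+\frac1{|\omega|}\int_{\mathbf R^3}\big[\mathcal A_\omega(x,\operatorname{curl}K_{U_0}+U_0)-\mathcal A_\omega(x,U_0)-\partial_u\mathcal A_\omega(x,U_0)(\operatorname{curl}K_{U_0})\big]\cdot P_0\,dx\\&+\frac1{|\omega|}\int_\omega\big[\partial_ua_1(U_0)-\partial_ua_2(U_0)\big](\operatorname{curl}K_{U_0})\cdot P_0\,dx,\end{aligned}$$ where $\mathcal A_\omega$ and $K_{U_0}$ are as in the context. Then for all $U_0,P_0\in\mathbf R^3$: (i) the mapping $P\mapsto dJ(\Omega)(U_0,P)$ is linear on $\mathbf R^3$; (ii) $dJ(\Omega)(R^\top U_0,R^\top P_0)=dJ(\Omega)(U_0,P_0)$ for all orthogonal matrices $R\in\mathbf R^{3\times3}$; (iii) if $U_0=|U_0|R_{U_0}e_1$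 and $P_0=|P_0|R_{P_0}e_1$ with orthogonal matrices $R_{U_0},R_{P_0}\in\mathbf R^{3\times3}$, and $(c_1,c_2,c_3)^\top:=|P_0|R_{U_0}^\top R_{P_0}e_1$ (new notation, unrelated to the constants above), then $$dJ(\Omega)(U_0,P_0)=c_1\,dJ(\Omega)(|U_0|e_1,e_1)+c_2\,dJ(\Omega)(|U_0|e_1,e_2)+c_3\,dJ(\Omega)(|U_0|e_1,e_3).$$
   Context: $e_1,e_2,e_3$ is the standard basis of $\mathbf R^3$. $\mathcal A_\omega(x,y):=a_1(y)\chi_\omega(x)+a_2(y)\chi_{\mathbf R^3\setminus\omega}(x)$; $\partial_u$ denotes the derivative with respect to $y$ (so $\partial_ua_i=\partial a_i$). $BLC(\mathbf R^3)$ is the closure of $\mathcal C:=\{\varphi\in C_c^\infty(\mathbf R^3)^3:\operatorname{div}\varphi=0\}$ with respect to $|\varphi|_{H(\mathbf R^3,\operatorname{curl})}:=\big(\int_{\mathbf R^3}|\operatorname{curl}\varphi|^2dx\big)^{1/2}$, understood as a completion realised by functions: $u\in L_{2,loc}(\mathbf R^3)^3$ belongs to $BLC(\mathbf R^3)$ iff there are a $|\cdot|_{H(\mathbf R^3,\operatorname{curl})}$-Cauchy sequence $(\varphi_n)\subset\mathcal C$ and constants $c_n\in\mathbf R^3$ with $\varphi_n+c_n\to u$ in $L_{2,loc}(\mathbf R^3)^3$. $\dot{BLC}(\mathbf R^3)$ is the quotient by constant (vector) functions. For $W\in\mathbf R^3$, $K_W\in\dot{BLC}(\mathbf R^3)$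 is the unique solution of $$\int_{\mathbf R^3}\big(\mathcal A_\omega(x,\operatorname{curl}K_W+W)-\mathcal A_\omega(x,W)\big)\cdot\operatorname{curl}\varphi\,dx=-\int_\omega(a_1(W)-a_2(W))\cdot\operatorname{curl}\varphi\,dx\quad\forall\varphi\in BLC(\mathbf R^3).$$ The symbol $\Omega$ in $dJ(\Omega)(U_0,P_0)$ is only notation; the expression depends only on $U_0,P_0$ (and $a_1,a_2,\omega$). *)

theory Defs
  imports "HOL-Analysis.Analysis"
begin

section \<open>Smooth fields on Euclidean space\<close>

primrec Ck :: "nat \<Rightarrow> ('a::euclidean_space \<Rightarrow> 'b::real_normed_vector) \<Rightarrow> bool" where
  "Ck 0 f \<longleftrightarrow> continuous_on UNIV f"
| "Ck (Suc k) f \<longleftrightarrow>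
     (\<forall>x. f differentiable (at x)) \<and> (\<forall>v. Ck k (\<lambda>x. frechet_derivative f (at x) v))"

definition smooth :: "('a::euclidean_space \<Rightarrow> 'b::real_normed_vector) \<Rightarrow> bool" where
  "smooth f \<longleftrightarrow> (\<forall>k. Ck k f)"

definition test_fields :: "(real^3 \<Rightarrow> real^3) set" where
  "test_fields = {\<phi>. smooth \<phi> \<and> compact (closure {x. \<phi> x \<noteq> 0})}"

text \<open>First index of \<open>pd\<close>: direction; second: component.\<close>

definition pd :: "(real^3 \<Rightarrow> real^3) \<Rightarrow> 3 \<Rightarrow> 3 \<Rightarrow> real^3 \<Rightarrow> real" where
  "pd f i j x = frechet_derivative f (at x) (axis i 1) $ j"

definition div3 :: "(real^3 \<Rightarrow> real^3) \<Rightarrow> real^3 \<Rightarrow> real" where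
  "div3 f x = (\<Sum>i\<in>UNIV. pd f i i x)"

definition curl :: "(real^3 \<Rightarrow> real^3) \<Rightarrow> real^3 \<Rightarrow> real^3" where
  "curl f x = vector [pd f 2 3 x - pd f 3 2 x, pd f 3 1 x - pd f 1 3 x, pd f 1 2 x - pd f 2 1 x]"


section \<open>Weak curl\<close>

definition locally_integrable :: "(real^3 \<Rightarrow> real^3) \<Rightarrow> bool" where
  "locally_integrable u \<longleftrightarrow> u \<in> borel_measurable lebesgue \<and>
     (\<forall>C. compact C \<longrightarrow> set_integrable lebesgue C u)"

definition has_weak_curl :: "(real^3 \<Rightarrow> real^3) \<Rightarrow> (real^3 \<Rightarrow> real^3) \<Rightarrow> bool" where
  "has_weak_curl u g \<longleftrightarrow> locally_integrable u \<and> locally_integrable g \<and>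
     (\<forall>\<psi>\<in>test_fields. (LINT x|lebesgue. u x \<bullet> curl \<psi> x) = (LINT x|lebesgue. g x \<bullet> \<psi> x))"

text \<open>The weak curl is determined up to null sets; a representative is chosen.\<close>

definition weak_curl :: "(real^3 \<Rightarrow> real^3) \<Rightarrow> real^3 \<Rightarrow> real^3" where
  "weak_curl u = (SOME g. has_weak_curl u g)"


section \<open>The Beppo Levi spaces for the curl\<close>

definition L2_loc :: "(real^3 \<Rightarrow> real^3) set" where
  "L2_loc = {u. u \<in> borel_measurable lebesgue \<and>
     (\<forall>C. compact C \<longrightarrow> set_integrable lebesgue C (\<lambda>x. (norm (u x))\<^sup>2))}"

definition tendsto_L2_loc :: "(nat \<Rightarrow> real^3 \<Rightarrow> real^3) \<Rightarrow> (real^3 \<Rightarrow> real^3) \<Rightarrow> bool" where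
  "tendsto_L2_loc f u \<longleftrightarrow>
     (\<forall>C. compact C \<longrightarrow> (\<lambda>n. LINT x:C|lebesgue. (norm (f n x - u x))\<^sup>2) \<longlonglongrightarrow> 0)"

definition solenoidal_tests :: "(real^3 \<Rightarrow> real^3) set" where
  "solenoidal_tests = {\<phi>\<in>test_fields. \<forall>x. div3 \<phi> x = 0}"

definition curl_norm :: "(real^3 \<Rightarrow> real^3) \<Rightarrow> real" where
  "curl_norm \<phi> = sqrt (LINT x|lebesgue. (norm (curl \<phi> x))\<^sup>2)"

definition BLC :: "(real^3 \<Rightarrow> real^3) set" where
  "BLC = {u\<in>L2_loc. \<exists>\<phi> c. (\<forall>n. \<phi> n \<in> solenoidal_tests) \<and>
     (\<forall>e>0. \<exists>N. \<forall>m\<ge>N. \<forall>n\<ge>N. curl_norm (\<lambda>x. \<phi> m x - \<phi> n x) < e) \<and>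
     tendsto_L2_loc (\<lambda>n x. \<phi> n x + c n) u}"

text \<open>Elements of \<open>BLC\<close> are functions, so the quotient by constants also identifies
  fields that agree almost everywhere.\<close>

definition BLC_rel :: "((real^3 \<Rightarrow> real^3) \<times> (real^3 \<Rightarrow> real^3)) set" where
  "BLC_rel = {(u, v). u \<in> BLC \<and> v \<in> BLC \<and> (\<exists>c. AE x in lebesgue. u x = v x + c)}"

definition BLC_dot :: "(real^3 \<Rightarrow> real^3) set set" where
  "BLC_dot = BLC // BLC_rel"

text \<open>All members of a class in \<open>BLC_dot\<close> have the same weak curl.\<close>

definition class_curl :: "(real^3 \<Rightarrow> real^3) set \<Rightarrow> real^3 \<Rightarrow> real^3" where
  "class_curl k = weak_curl (SOME u. u \<in> k)"


section \<open>The exterior problem and the topological derivative\<close>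

definition A_om ::
  "(real^3 \<Rightarrow> real^3) \<Rightarrow> (real^3 \<Rightarrow> real^3) \<Rightarrow> (real^3) set \<Rightarrow> real^3 \<Rightarrow> real^3 \<Rightarrow> real^3" where
  "A_om a1 a2 \<omega> x y = indicat_real \<omega> x *\<^sub>R a1 y + indicat_real (- \<omega>) x *\<^sub>R a2 y"

definition solves_K ::
  "(real^3 \<Rightarrow> real^3) \<Rightarrow> (real^3 \<Rightarrow> real^3) \<Rightarrow> (real^3) set \<Rightarrow> real^3 \<Rightarrow> (real^3 \<Rightarrow> real^3) set \<Rightarrow> bool"
  where
  "solves_K a1 a2 \<omega> W k \<longleftrightarrow> k \<in> BLC_dot \<and>
     (\<forall>\<phi>\<in>BLC.
        (LINT x|lebesgue. (A_om a1 a2 \<omega> x (class_curl k x + W) - A_om a1 a2 \<omega> x W) \<bullet> weak_curl \<phi> x)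
        = - (LINT x:\<omega>|lebesgue. (a1 W - a2 W) \<bullet> weak_curl \<phi> x))"

text \<open>\<open>K a1 a2 \<omega> W\<close> is the unique solution in \<open>BLC_dot\<close>. If \<open>a1\<close>, \<open>a2\<close> are strongly
  monotone and Lipschitz and \<open>\<omega>\<close> is bounded and measurable, it exists; the value outside
  the well-posed case (the class of the zero field) is a convention.\<close>

definition K ::
  "(real^3 \<Rightarrow> real^3) \<Rightarrow> (real^3 \<Rightarrow> real^3) \<Rightarrow> (real^3) set \<Rightarrow> real^3 \<Rightarrow> (real^3 \<Rightarrow> real^3) set" where
  "K a1 a2 \<omega> W = (if \<exists>!k. solves_K a1 a2 \<omega> W k then THE k. solves_K a1 a2 \<omega> W k
                   else BLC_rel `` {\<lambda>x. 0})"

definition dJ ::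
  "(real^3 \<Rightarrow> real^3) \<Rightarrow> (real^3 \<Rightarrow> real^3) \<Rightarrow> (real^3) set \<Rightarrow> real^3 \<Rightarrow> real^3 \<Rightarrow> real" where
  "dJ a1 a2 \<omega> U P =
     (let g = class_curl (K a1 a2 \<omega> U) in
      (a1 U - a2 U) \<bullet> P
      + 1 / measure lebesgue \<omega> *
        (LINT x|lebesgue. (A_om a1 a2 \<omega> x (g x + U) - A_om a1 a2 \<omega> x U
                           - frechet_derivative (A_om a1 a2 \<omega> x) (at U) (g x)) \<bullet> P)
      + 1 / measure lebesgue \<omega> *
        (LINT x:\<omega>|lebesgue. (frechet_derivative a1 (at U) (g x)
                              - frechet_derivative a2 (at U) (g x)) \<bullet> P))"

end

theory Submission
  imports Defs
begin

text \<open>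
  An orthogonal matrix \<open>R\<close> acts on fields by \<open>u \<mapsto> det R R\<^sup>T u(R x)\<close>. This action preserves the
  space \<open>BLC\<close> and turns \<open>curl u\<close> into \<open>R\<^sup>T (curl u)(R x)\<close>, reflections included. Since \<open>a\<^sub>1\<close>, \<open>a\<^sub>2\<close>
  are equivariant and the ball is invariant, it maps the solutions of the exterior problem for \<open>W\<close>
  bijectively onto those for \<open>R\<^sup>T W\<close>; hence \<open>K\<close> is equivariant even without knowing that
  solutions exist, and the change of variables \<open>x \<mapsto> R x\<close> in the integrals gives (ii).
  Linearity in \<open>P\<close> needs that both integrands are integrable: the first one is at most
  \<open>c\<^sub>3 |curl K|\<^sup>2\<close> by Taylor's formula, and the weak curl of a field in \<open>BLC\<close> is square integrable by
  completeness of \<open>L\<^sub>2\<close>. As the weak curl is a chosen representative, all this requires its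
  uniqueness almost everywhere, i.e. the fundamental lemma of the calculus of variations.
  Statement (iii) is (ii) for \<open>R = R\<^sub>U\<close> combined with (i).
\<close>

section \<open>Smooth cutoff functions\<close>

text \<open>A potential and its curl must follow different laws. Since \<open>a1\<close> and
  \<open>a2\<close> are equivariant, \<open>W\<close> and therefore the curl of \<open>K\<close>
  have to rotate like ordinary vectors. The cross product, however, satisfies Rh x Rk = det R R(h x
  k), so a potential that rotated like an ordinary vector would have a curl with the wrong sign
  under reflections, and the rotated field would not solve the rotated equation. The factor
  \<open>det R\<close> repairs this because its square is 1. \<open>K\<close> is a THE guarded by
  unique existence, so the guard itself has to be transported, in both directions, and the fallback
  class must be fixed by the action. The changes of variables ask for measurability alone, since the
  Bochner integral of a nonintegrable function is 0 on both sides; pulling \<open>P\<close> out of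
  an integral is different and needs integrability. Smoothness is the recursive predicate
  \<open>Ck\<close> over directional derivatives, so smooth test functions are built from an
  explicit family that is stable under differentiation.\<close>

lemma CkI:
  assumes "\<And>x. (f has_derivative F x) (at x)" and "\<And>v. Ck k (\<lambda>x. F x v)"
  shows "Ck (Suc k) f"
proof -
  have "frechet_derivative f (at x) = F x" for x
    using assms(1) frechet_derivative_at by metis
  then show ?thesis
    using assms by (auto simp: differentiable_def)
qed

lemma Ck_has_derivative:
  "Ck (Suc k) f \<Longrightarrow> (f has_derivative frechet_derivative f (at x)) (at x)"
  by (simp add: frechet_derivative_works)

text \<open>Order \<open>Suc k\<close> speaks about derivatives only. At the bottom of the recursion
  differentiability supplies continuity; above it the claim passes to each directional
  derivative.\<close>

lemma Ck_SucD: "Ck (Suc k) f \<Longrightarrow> Ck k f"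
proof (induction k arbitrary: f)
  case 0
  then show ?case
    by (auto intro!: differentiable_imp_continuous_on simp: differentiable_on_def
        intro: differentiable_at_withinI)
next
  case (Suc k)
  then show ?case by simp
qed

lemma Ck_const: "Ck k (\<lambda>x. c)"
proof (induction k arbitrary: c)
  case (Suc k)
  show ?case by (rule CkI[of _ "\<lambda>x v. 0"]) (use Suc in auto)
qed simp

lemma Ck_add: "Ck k f \<Longrightarrow> Ck k g \<Longrightarrow> Ck k (\<lambda>x. f x + g x)"
proof (induction k arbitrary: f g)
  case (Suc k)
  show ?case
    by (rule CkI[OF has_derivative_add[OF Suc.prems[THEN Ck_has_derivative]]])
      (use Suc in auto)
qed (auto intro: continuous_intros)

lemma Ck_linear_compose:
  assumes "bounded_linear L"
  shows "Ck k f \<Longrightarrow> Ck k (\<lambda>x. L (f x))"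
proof (induction k arbitrary: f)
  case 0
  then show ?case by (simp add: bounded_linear.continuous_on[OF assms])
next
  case (Suc k)
  show ?case
    by (rule CkI[OF bounded_linear.has_derivative[OF assms Ck_has_derivative[OF Suc.prems]]])
      (use Suc in auto)
qed

lemma Ck_compose_affine:
  assumes L: "bounded_linear L"
  shows "Ck k f \<Longrightarrow> Ck k (\<lambda>x. f (L x + c))"
proof (induction k arbitrary: f)
  case 0
  then have "continuous_on UNIV (f \<circ> (\<lambda>x. L x + c))"
    by (intro continuous_on_compose continuous_intros bounded_linear.continuous_on[OF L])
      (auto intro: continuous_on_subset)
  then show ?case by (simp add: o_def)
next
  case (Suc k)
  have "((\<lambda>x. L x + c) has_derivative L) (at x)" for x
    using L by (auto intro!: derivative_eq_intros bounded_linear_imp_has_derivative)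
  from has_derivative_compose[OF this Ck_has_derivative[OF Suc.prems]]
  show ?case
    by (rule CkI) (use Suc in auto)
qed

text \<open>The Leibniz rule leaves undifferentiated factors, which have order \<open>Suc k\<close>
  while the induction hypothesis wants order \<open>k\<close>; this is where lowering the order is
  used.\<close>

lemma Ck_bilinear:
  assumes "bounded_bilinear pr"
  shows "Ck k f \<Longrightarrow> Ck k g \<Longrightarrow> Ck k (\<lambda>x. pr (f x) (g x))"
proof (induction k arbitrary: f g)
  case 0
  then show ?case by (simp add: bounded_bilinear.continuous_on[OF assms])
next
  case (Suc k)
  have "Ck k f" "Ck k g"
    using Suc.prems Ck_SucD by blast+
  then show ?case
    by (intro CkI[OF bounded_bilinear.FDERIV[OF assms Suc.prems[THEN Ck_has_derivative]]] Ck_add Suc.IH)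
      (use Suc.prems in auto)
qed

lemma Ck_prod:
  fixes f :: "'i \<Rightarrow> 'a::euclidean_space \<Rightarrow> real"
  assumes "finite I" "\<And>i. i \<in> I \<Longrightarrow> Ck k (f i)"
  shows "Ck k (\<lambda>x. \<Prod>i\<in>I. f i x)"
  using assms
proof (induction I)
  case empty
  show ?case by (simp add: Ck_const)
next
  case (insert i I)
  then show ?case
    by (simp add: Ck_bilinear[OF bounded_bilinear_mult])
qed

text \<open>For positive t this is t^(-k) exp(-1/t), extended by 0. The powers are included because
  differentiation of exp(-1/t) produces them: the span of the whole family is stable under
  derivatives, so smoothness can be proved for all \<open>k\<close> simultaneously.\<close>

definition flat :: "nat \<Rightarrow> real \<Rightarrow> real" where
  "flat k t = (if t > 0 then (1 / t) ^ k / exp (1 / t) else 0)"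

lemma DERIV_flat:
  "(flat k has_field_derivative flat (k + 2) t - of_nat k * flat (k + 1) t) (at t)"
proof -
  consider "t < 0" | "t = 0" | "t > 0" by linarith
  then show ?thesis
  proof cases
    case 1
    then have "\<forall>\<^sub>F s in nhds t. flat k s = 0"
      by (intro eventually_nhds_in_open[THEN eventually_mono, of "{..<0}"]) (auto simp: flat_def)
    then show ?thesis
      using 1 by (subst DERIV_cong_ev[OF refl _ refl, where g = "\<lambda>_. 0"]) (auto simp: flat_def)
  next
    case 3
    then have "\<forall>\<^sub>F s in nhds t. flat k s = (1 / s) ^ k / exp (1 / s)"
      by (intro eventually_nhds_in_open[THEN eventually_mono, of "{0<..}"]) (auto simp: flat_def)
    moreover have "((\<lambda>s. (1 / s) ^ k / exp (1 / s)) has_field_derivative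
        flat (k + 2) t - of_nat k * flat (k + 1) t) (at t)"
    proof -
      define u where "u = 1 / t"
      have "((\<lambda>s. 1 / s) has_field_derivative - u\<^sup>2) (at t)"
        using 3 by (auto intro!: derivative_eq_intros simp: u_def power2_eq_square)
      from DERIV_divide[OF DERIV_power[OF this, of k] DERIV_fun_exp[OF this]]
      have "((\<lambda>s. (1 / s) ^ k / exp (1 / s)) has_field_derivative
          (real k * (- u\<^sup>2 * u ^ (k - 1)) * exp u - u ^ k * (exp u * - u\<^sup>2)) / (exp u * exp u)) (at t)"
        unfolding u_def by (simp add: mult_ac)
      \<comment> \<open>The case split is due to the truncated exponent \<open>k - 1\<close> at
        \<open>k = 0\<close>, where the factor \<open>k\<close> removes the term.\<close>
      then show ?thesis
        using 3 by (cases k)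
          (simp_all add: flat_def u_def[symmetric] diff_divide_distrib power2_eq_square mult_ac)
    qed
    ultimately show ?thesis
      by (subst DERIV_cong_ev[OF refl _ refl])
  next
    case 2
    \<comment> \<open>The difference quotient at 0 from the right is again a power of 1/s over
      exp(1/s), with exponent \<open>Suc k\<close>; the exponential wins. From the left the quotient
      vanishes identically.\<close>
    have lim: "((\<lambda>s::real. (1 / s) ^ Suc k / exp (1 / s)) \<longlongrightarrow> 0) (at_right 0)"
      by (rule filterlim_compose[OF tendsto_power_div_exp_0])
        (simp add: filterlim_inverse_at_top_right inverse_eq_divide[symmetric])
    have "((\<lambda>s. flat k s / s) \<longlongrightarrow> 0) (at 0)"
    proof (rule filterlim_split_at)
      show "((\<lambda>s. flat k s / s) \<longlongrightarrow> 0) (at_left 0)"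
        by (rule tendsto_eventually) (auto simp: flat_def eventually_at_filter)
      show "((\<lambda>s. flat k s / s) \<longlongrightarrow> 0) (at_right 0)"
        by (rule Lim_transform_eventually[OF lim])
          (auto simp: flat_def eventually_at_filter field_simps)
    qed
    then show ?thesis
      using 2 by (simp add: has_field_derivative_iff flat_def)
  qed
qed

lemma Ck_flat: "Ck m (flat k)"
proof (induction m arbitrary: k)
  case 0
  show ?case
    by (auto intro!: continuous_at_imp_continuous_on DERIV_isCont DERIV_flat)
next
  case (Suc m)
  have "(flat k has_derivative (\<lambda>v. (flat (k + 2) t + - real k *\<^sub>R flat (k + 1) t) *\<^sub>R v)) (at t)" for t
    using DERIV_flat[of k t] by (simp add: has_field_derivative_def mult_commute_abs)
  then show ?case
    by (rule CkI) (intro Ck_bilinear[OF bounded_bilinear_scaleR] Ck_add Ck_const Suc.IH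
        Ck_linear_compose[OF bounded_linear_scaleR_right])
qed

text \<open>A coordinatewise product of factors exp(-1/(n s)), where s is the signed distance to a
  face. It vanishes off the open box, and stretching by \<open>n\<close> drives every factor to 1
  inside. It need not equal 1 anywhere: pointwise convergence to the indicator, with values in
  [0,1], suffices for dominated convergence.\<close>

definition cutoff :: "'a::euclidean_space \<Rightarrow> 'a \<Rightarrow> nat \<Rightarrow> 'a \<Rightarrow> real" where
  "cutoff a b n x = (\<Prod>i\<in>Basis.
     flat 0 (real n * (x \<bullet> i - a \<bullet> i)) * flat 0 (real n * (b \<bullet> i - x \<bullet> i)))"

lemma flat_0_bounds: "0 \<le> flat 0 t" "flat 0 t \<le> 1"
  by (auto simp: flat_def)

lemma cutoff_bounds: "0 \<le> cutoff a b n x" "cutoff a b n x \<le> 1"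
  unfolding cutoff_def
  by (auto intro!: prod_nonneg prod_le_1 mult_nonneg_nonneg mult_le_one simp: flat_0_bounds)

lemma cutoff_zero: "x \<notin> box a b \<Longrightarrow> cutoff a b n x = 0"
  unfolding cutoff_def
  by (auto simp: mem_box flat_def zero_less_mult_iff)

lemma smooth_cutoff: "smooth (cutoff a b n)"
  unfolding smooth_def
proof
  fix k
  have 1: "bounded_linear (\<lambda>x. real n * (x \<bullet> i))" and 2: "bounded_linear (\<lambda>x. - (real n * (x \<bullet> i)))"
    for i :: 'a
    by (intro bounded_linear_minus bounded_linear_const_mult bounded_linear_inner_left_comp bounded_linear_ident)+
  show "Ck k (cutoff a b n)"
    unfolding cutoff_def
    by (intro Ck_prod Ck_bilinear[OF bounded_bilinear_mult] finite_Basis)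
      (use Ck_compose_affine[OF 1 Ck_flat, where c = "- (real n * (a \<bullet> i))" for i]
        Ck_compose_affine[OF 2 Ck_flat, where c = "real n * (b \<bullet> i)" for i] in \<open>auto simp: algebra_simps\<close>)
qed

lemma cutoff_tendsto: "(\<lambda>n. cutoff a b n x) \<longlonglongrightarrow> indicator (box a b) x"
proof (cases "x \<in> box a b")
  case True
  have "(\<lambda>n. flat 0 (real n * s)) \<longlonglongrightarrow> 1" if "s > 0" for s
  proof -
    have "(\<lambda>n. 1 / exp (inverse s * inverse (real n))) \<longlonglongrightarrow> 1 / exp (inverse s * 0)"
      by (intro tendsto_intros lim_inverse_n) auto
    moreover have "\<forall>\<^sub>F n in sequentially. 1 / exp (inverse s * inverse (real n)) = flat 0 (real n * s)"
      using eventually_gt_at_top[of 0]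
      by eventually_elim (use that in \<open>auto simp: flat_def field_simps\<close>)
    ultimately show ?thesis
      using Lim_transform_eventually by fastforce
  qed
  then have "(\<lambda>n. cutoff a b n x) \<longlonglongrightarrow> (\<Prod>i\<in>(Basis::'a set). 1 * 1)"
    unfolding cutoff_def using True
    by (intro tendsto_prod tendsto_mult) (auto simp: mem_box)
  then show ?thesis using True by simp
qed (simp add: cutoff_zero)

section \<open>The fundamental lemma of the calculus of variations\<close>

lemma continuous_imp_borel_measurable_lebesgue:
  "continuous_on UNIV f \<Longrightarrow> f \<in> borel_measurable lebesgue"
  using measurable_completion[of f lborel borel] by (simp add: borel_measurable_continuous_onI)

lemma frechet_derivative_eq_0_outside_support:
  fixes f :: "'a::euclidean_space \<Rightarrow> 'b::real_normed_vector"
  assumes "x \<notin> closure {x. f x \<noteq> 0}"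
  shows "frechet_derivative f (at x) = (\<lambda>_. 0)"
proof -
  have "((\<lambda>_. 0) has_derivative (\<lambda>_. 0)) (at x)"
    by simp
  then have "(f has_derivative (\<lambda>_. 0)) (at x)"
    by (rule has_derivative_transform_within_open[of _ _ _ _ "- closure {x. f x \<noteq> 0}"])
      (use assms closure_subset[of "{x. f x \<noteq> 0}"] in auto)
  then show ?thesis
    using frechet_derivative_at by metis
qed

lemma bounded_support_frechet_derivative:
  fixes f :: "'a::euclidean_space \<Rightarrow> 'b::real_normed_vector"
  assumes "bounded {x. f x \<noteq> 0}"
  shows "bounded {x. frechet_derivative f (at x) v \<noteq> 0}"
proof (rule bounded_subset)
  show "bounded (closure {x. f x \<noteq> 0})"
    by (rule bounded_closure[OF assms])
qed (use frechet_derivative_eq_0_outside_support in fastforce)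

lemma integrable_continuous_bounded_support:
  fixes f :: "'a::euclidean_space \<Rightarrow> 'b::euclidean_space"
  assumes "continuous_on UNIV f" "bounded {x. f x \<noteq> 0}"
  shows "integrable lborel f" "integrable lebesgue f"
proof -
  have "integrable lborel (\<lambda>x. indicator (closure {x. f x \<noteq> 0}) x *\<^sub>R f x)"
    using assms by (intro borel_integrable_compact) (auto intro: continuous_on_subset)
  moreover have "(\<lambda>x. indicator (closure {x. f x \<noteq> 0}) x *\<^sub>R f x) = f"
    using closure_subset[of "{x. f x \<noteq> 0}"] by (auto simp: fun_eq_iff indicator_def)
  ultimately show "integrable lborel f"
    by simp
  then show "integrable lebesgue f"
    by (simp add: integrable_completion)
qed

lemma continuous_bounded_support_bounded:
  fixes f :: "'a::euclidean_space \<Rightarrow> 'b::euclidean_space"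
  assumes "continuous_on UNIV f" "bounded {x. f x \<noteq> 0}"
  obtains B where "\<And>x. norm (f x) \<le> B" "B \<ge> 0"
proof -
  have "bounded (f ` closure {x. f x \<noteq> 0})"
    using assms by (intro compact_imp_bounded compact_continuous_image) (auto intro: continuous_on_subset)
  then obtain B where B: "\<And>x. x \<in> closure {x. f x \<noteq> 0} \<Longrightarrow> norm (f x) \<le> B"
    by (auto simp: bounded_iff)
  have "norm (f x) \<le> max B 0" for x
    using B[of x] closure_subset[of "{x. f x \<noteq> 0}"] by (cases "f x = 0") (auto simp: le_max_iff_disj)
  then show ?thesis
    using that[of "max B 0"] by auto
qed

text \<open>The integral of a difference quotient vanishes by translation invariance.\<close>

lemma integral_directional_derivative:
  fixes f :: "'a::euclidean_space \<Rightarrow> 'b::euclidean_space"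
  assumes f: "Ck 1 f" and supp: "bounded {x. f x \<noteq> 0}"
  shows "(LINT x|lebesgue. frechet_derivative f (at x) v) = 0"
proof -
  define D where "D x = frechet_derivative f (at x) v" for x
  have der: "(f has_derivative frechet_derivative f (at x)) (at x)" for x
    using f Ck_has_derivative[of 0 f] by simp
  have cf: "continuous_on UNIV f" and cD: "continuous_on UNIV D"
    using f Ck_SucD[of 0 f] by (auto simp: D_def[abs_def])
  have sD: "bounded {x. D x \<noteq> 0}"
    unfolding D_def by (rule bounded_support_frechet_derivative[OF supp])
  obtain B where B: "\<And>x. norm (D x) \<le> B" "B \<ge> 0"
    using continuous_bounded_support_bounded[OF cD sD] by blast
  obtain r where r: "\<And>x. f x \<noteq> 0 \<Longrightarrow> norm x \<le> r"
    using supp by (auto simp: bounded_iff)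
  \<comment> \<open>Difference quotients with step 1/(n+1) in direction \<open>v\<close>;
    \<open>Suc n\<close> avoids division by zero. Each has integral 0, and they converge pointwise
    to the derivative \<open>D\<close>.\<close>
  define q where "q n x = real (Suc n) *\<^sub>R (f (x + (1 / real (Suc n)) *\<^sub>R v) - f x)" for n x
  have path: "((\<lambda>t. f (x + t *\<^sub>R v)) has_derivative (\<lambda>s. s *\<^sub>R D (x + t *\<^sub>R v))) (at t)" for x t
  proof -
    have "((\<lambda>t. x + t *\<^sub>R v) has_derivative (\<lambda>s. s *\<^sub>R v)) (at t)"
      by (auto intro!: derivative_eq_intros)
    from has_derivative_compose[OF this der]
    show ?thesis
      by (simp add: D_def linear_cmul[OF has_derivative_linear[OF der]])
  qed
  have fi: "integrable lborel f"
    by (rule integrable_continuous_bounded_support[OF cf supp])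
  have shift: "integrable lborel (\<lambda>x. f (x + a))" "(LINT x|lborel. f (x + a)) = (LINT x|lborel. f x)" for a
  proof -
    have "distr lborel borel (\<lambda>x. x + a) = lborel"
      using lborel_distr_plus[of a] by (simp only: add.commute[of _ a])
    then show "integrable lborel (\<lambda>x. f (x + a))" "(LINT x|lborel. f (x + a)) = (LINT x|lborel. f x)"
      using fi integrable_distr[of "\<lambda>x. x + a" lborel borel f] integral_distr[of "\<lambda>x. x + a" lborel borel f]
        borel_measurable_continuous_onI[OF cf]
      by simp_all
  qed
  have qi: "integrable lborel (q n)" for n
    unfolding q_def[abs_def]
    by (intro integrable_scaleR_right Bochner_Integration.integrable_diff shift fi)
  have qint: "(LINT x|lborel. q n x) = 0" for n
    using shift[of "(1 / real (Suc n)) *\<^sub>R v"] fi by (simp add: q_def)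
  have "(\<lambda>n. LINT x|lborel. q n x) \<longlonglongrightarrow> (LINT x|lborel. D x)"
  proof (rule integral_dominated_convergence)
    show "D \<in> borel_measurable lborel" "q n \<in> borel_measurable lborel" for n
      using borel_measurable_continuous_onI[OF cD] borel_measurable_integrable[OF qi] by simp_all
    \<comment> \<open>The dominating function is the constant \<open>B\<close> on a ball. The shift
      has length at most |v|, so the quotient vanishes outside the ball of radius r + |v| for every
      \<open>n\<close>.\<close>
    have "integrable lborel (\<lambda>x. indicator (cball 0 (r + norm v)) x *\<^sub>R B)"
      by (intro borel_integrable_compact) auto
    then show "integrable lborel (\<lambda>x::'a. B * indicator (cball 0 (r + norm v)) x)"
      by (simp add: mult.commute)
    show "AE x in lborel. (\<lambda>n. q n x) \<longlonglongrightarrow> D x"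
    proof (rule AE_I2)
      fix x
      have "((\<lambda>h. norm (f (x + h *\<^sub>R v) - f x - h *\<^sub>R D x) / norm h) \<longlongrightarrow> 0) (at 0)"
        using path[of x 0] by (simp add: has_derivative_at)
      moreover have "filterlim (\<lambda>n. 1 / real (Suc n)) (at 0) sequentially"
        using LIMSEQ_inverse_real_of_nat by (intro filterlim_atI) (auto simp: inverse_eq_divide)
      ultimately have "(\<lambda>n. norm (f (x + (1 / real (Suc n)) *\<^sub>R v) - f x - (1 / real (Suc n)) *\<^sub>R D x)
          / norm (1 / real (Suc n))) \<longlonglongrightarrow> 0"
        by (rule filterlim_compose)
      moreover have "norm (f (x + (1 / real (Suc n)) *\<^sub>R v) - f x - (1 / real (Suc n)) *\<^sub>R D x)
          / norm (1 / real (Suc n)) = norm (q n x - D x)" for n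
      proof -
        have "q n x - D x = real (Suc n) *\<^sub>R
            (f (x + (1 / real (Suc n)) *\<^sub>R v) - f x - (1 / real (Suc n)) *\<^sub>R D x)"
          by (simp add: q_def scaleR_diff_right)
        then show ?thesis
          by (simp add: mult.commute)
      qed
      ultimately show "(\<lambda>n. q n x) \<longlonglongrightarrow> D x"
        by (simp add: tendsto_norm_zero_iff LIM_zero_iff)
    qed
    fix n
    show "AE x in lborel. norm (q n x) \<le> B * indicator (cball 0 (r + norm v)) x"
    proof (rule AE_I2)
      fix x
      \<comment> \<open>The mean value inequality along the segment in direction \<open>v\<close>
        bounds the quotient by \<open>B\<close> uniformly in \<open>n\<close>.\<close>
      have "norm (f (x + (1 / real (Suc n)) *\<^sub>R v) - f (x + 0 *\<^sub>R v)) \<le> B * norm (1 / real (Suc n) - 0)"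
      proof (rule differentiable_bound[OF convex_UNIV])
        show "onorm (\<lambda>s. s *\<^sub>R D (x + t *\<^sub>R v)) \<le> B" for t
          using B by (intro onorm_le) (simp add: mult.commute[of B] mult_left_mono)
      qed (use path in auto)
      then have "real (Suc n) * norm (f (x + (1 / real (Suc n)) *\<^sub>R v) - f x)
          \<le> real (Suc n) * (B * norm (1 / real (Suc n)))"
        by (intro mult_left_mono) auto
      then have 1: "norm (q n x) \<le> B"
        by (simp add: q_def del: of_nat_Suc)
      have "norm x \<le> r + norm v" if "q n x \<noteq> 0"
      proof -
        have "f (x + (1 / real (Suc n)) *\<^sub>R v) \<noteq> 0 \<or> f x \<noteq> 0"
          using that by (auto simp: q_def)
        moreover have "norm ((1 / real (Suc n)) *\<^sub>R v) \<le> norm v"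
          by (simp add: divide_le_eq mult_le_cancel_left1)
        moreover have "norm x \<le> norm (x + (1 / real (Suc n)) *\<^sub>R v) + norm ((1 / real (Suc n)) *\<^sub>R v)"
          using norm_triangle_ineq4[of "x + (1 / real (Suc n)) *\<^sub>R v" "(1 / real (Suc n)) *\<^sub>R v"] by simp
        ultimately show ?thesis
          using r[of x] r[of "x + (1 / real (Suc n)) *\<^sub>R v"] norm_ge_zero[of v] by linarith
      qed
      then show "norm (q n x) \<le> B * indicator (cball 0 (r + norm v)) x"
        using 1 by (cases "q n x = 0") (auto simp: indicator_def B)
    qed
  qed
  then have "(LINT x|lborel. D x) = 0"
    by (simp add: qint LIMSEQ_const_iff)
  then show ?thesis
    using borel_measurable_continuous_onI[OF cD] integral_completion[of D lborel]
    by (simp add: D_def[abs_def])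
qed

text \<open>Completion leaves the measure of Borel sets unchanged, so a countable cover for
  \<open>lborel\<close> serves. Sigma-finiteness is what the density argument below
  requires.\<close>

lemma sigma_finite_lebesgue: "sigma_finite_measure (lebesgue :: 'a::euclidean_space measure)"
proof
  obtain A :: "'a set set" where A: "countable A" "A \<subseteq> sets lborel" "\<Union>A = space lborel"
    "\<forall>a\<in>A. emeasure lborel a \<noteq> \<infinity>"
    using lborel.sigma_finite_countable by blast
  then have "A \<subseteq> sets lebesgue" "\<Union>A = space lebesgue"
    using A sets_completionI_sets by auto
  moreover have "emeasure lebesgue a \<noteq> \<infinity>" if "a \<in> A" for a
  proof -
    have "a \<in> sets lborel"
      using that A(2) by blast
    then have "emeasure lebesgue a = emeasure lborel a"
      by simp
    then show ?thesis
      using A(4) that by simp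
  qed
  ultimately show "\<exists>A::'a set set. countable A \<and> A \<subseteq> sets lebesgue \<and> \<Union>A = space lebesgue \<and>
      (\<forall>a\<in>A. emeasure lebesgue a \<noteq> \<infinity>)"
    by (intro exI[of _ A] conjI ballI A(1))
qed

text \<open>Truncation to a large box makes \<open>f\<close> integrable. The sets over which the
  truncation integrates to 0 form a Dynkin system containing the intersection-stable family of
  boxes, hence contain all Borel sets, and then all Lebesgue sets; such a function is 0 almost
  everywhere.\<close>

lemma AE_zero_if_box_integrals_zero:
  fixes f :: "'a::euclidean_space \<Rightarrow> 'b::euclidean_space"
  assumes int: "\<And>C. compact C \<Longrightarrow> set_integrable lebesgue C f"
    and zero: "\<And>a b. (LINT x:box a b|lebesgue. f x) = 0"
  shows "AE x in lebesgue. f x = 0"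
proof -
  have "AE x in lebesgue. x \<in> box (- (real n *\<^sub>R One)) (real n *\<^sub>R One) \<longrightarrow> f x = 0" for n
  proof -
    define Q where "Q = box (- (real n *\<^sub>R One)) (real n *\<^sub>R One :: 'a)"
    define h where "h x = indicator Q x *\<^sub>R f x" for x
    have h: "integrable lebesgue h"
    proof -
      have "set_integrable lebesgue (closure Q) f"
        by (rule int) (simp add: Q_def)
      then have "set_integrable lebesgue Q f"
        by (rule set_integrable_subset) (auto simp: Q_def closure_subset)
      then show ?thesis
        by (simp add: set_integrable_def h_def[abs_def])
    qed
    have hs: "set_integrable lebesgue A h" if "A \<in> sets lebesgue" for A
      using integrable_mult_indicator[OF that h] by (simp add: set_integrable_def)
    \<comment> \<open>Truncation does no harm, since the intersection of two boxes is a box.\<close>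
    have box: "(LINT x:box a b|lebesgue. h x) = 0" for a b
    proof -
      have "(\<lambda>x. indicator (box a b) x *\<^sub>R h x) = (\<lambda>x. indicator (box a b \<inter> Q) x *\<^sub>R f x)"
        by (auto simp: h_def indicator_def fun_eq_iff)
      then show ?thesis
        using zero unfolding Q_def box_Int_box by (simp add: set_lebesgue_integral_def)
    qed
    \<comment> \<open>The vanishing total integral is what closes the Dynkin system under
      complements.\<close>
    have tot: "(LINT x|lebesgue. h x) = 0"
      using zero by (simp add: h_def Q_def set_lebesgue_integral_def)
    have borel0: "(LINT x:A|lebesgue. h x) = 0" if "A \<in> sets borel" for A
    proof -
      have sigma: "sigma_sets UNIV (range (\<lambda>(a, b). box a b)) = sets (borel :: 'a measure)"
        by (subst borel_eq_box) (simp add: sets_measure_of)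
      have "Int_stable (range (\<lambda>(a, b). box a b :: 'a set))"
      proof -
        have "box a b \<in> range (\<lambda>(a, b). box a b)" for a b :: 'a
          by (rule range_eqI[of _ _ "(a, b)"]) simp
        then show ?thesis
          by (auto simp: Int_stable_def box_Int_box)
      qed
      moreover have "range (\<lambda>(a, b). box a b :: 'a set) \<subseteq> Pow UNIV"
        by simp
      moreover have "A \<in> sigma_sets UNIV (range (\<lambda>(a, b). box a b))"
        using that sigma by simp
      ultimately show ?thesis
      proof (induction rule: sigma_sets_induct_disjoint)
        case (compl A)
        then have A: "A \<in> sets lebesgue"
          by (simp add: sigma)
        have "(LINT x:UNIV - A|lebesgue. h x) = (LINT x|lebesgue. h x - indicator A x *\<^sub>R h x)"
          by (auto simp: set_lebesgue_integral_def indicator_def intro!: Bochner_Integration.integral_cong)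
        also have "\<dots> = 0"
          using compl hs[OF A] h tot by (simp add: set_lebesgue_integral_def set_integrable_def)
        finally show ?case .
      next
        case (union A)
        then have A: "A i \<in> sets lebesgue" for i
          by (auto simp: sigma)
        have "(LINT x:(\<Union>i. A i)|lebesgue. h x) = (\<Sum>i. (LINT x:A i|lebesgue. h x))"
          using A union.hyps(1)
          by (intro lebesgue_integral_countable_add hs) (auto simp: disjoint_family_on_def)
        then show ?case
          using union by simp
      qed (use box in \<open>auto simp: set_lebesgue_integral_def\<close>)
    qed
    have "AE x in lebesgue. h x = 0"
    proof (rule sigma_finite_measure.density_zero[OF sigma_finite_lebesgue h])
      fix A :: "'a set" assume A: "A \<in> sets lebesgue"
      \<comment> \<open>A Lebesgue set is a Borel set up to a subset of a Borel null set, which does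
        not affect the integral.\<close>
      then obtain S N N' where SN: "A = S \<union> N" "N \<subseteq> N'" "N' \<in> null_sets lborel" "S \<in> sets borel"
        by (elim sets_completionE) auto
      have "AE x in lebesgue. x \<notin> N'"
        using SN by (intro AE_not_in null_sets_completionI)
      then have "AE x in lebesgue. indicator A x *\<^sub>R h x = indicator S x *\<^sub>R h x"
        by (rule AE_mp) (use SN in \<open>auto intro!: AE_I2 simp: indicator_def\<close>)
      moreover have "S \<in> sets lebesgue"
        using SN(4) by (simp add: sets_completionI_sets)
      ultimately have "(LINT x:A|lebesgue. h x) = (LINT x:S|lebesgue. h x)"
        unfolding set_lebesgue_integral_def
        using hs[OF A] hs[of S] unfolding set_integrable_def
        by (intro integral_cong_AE borel_measurable_integrable)
      then show "(LINT x:A|lebesgue. h x) = 0"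
        using borel0[OF SN(4)] by simp
    qed
    then show ?thesis
      by (auto simp: h_def Q_def)
  qed
  then have "AE x in lebesgue. \<forall>n. x \<in> box (- (real n *\<^sub>R One)) (real n *\<^sub>R One) \<longrightarrow> f x = 0"
    by (intro AE_all_countable[THEN iffD2] allI)
  then show ?thesis
  proof (rule AE_mp, intro AE_I2 impI)
    fix x :: 'a
    assume "\<forall>n. x \<in> box (- (real n *\<^sub>R One)) (real n *\<^sub>R One) \<longrightarrow> f x = 0"
    moreover have "x \<in> (\<Union>n::nat. box (- (real n *\<^sub>R One)) (real n *\<^sub>R One))"
      by (simp only: UN_box_eq_UNIV UNIV_I)
    then obtain n :: nat where "x \<in> box (- (real n *\<^sub>R One)) (real n *\<^sub>R One)"
      by (rule UN_E)
    ultimately show "f x = 0"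
      by blast
  qed
qed

section \<open>Test fields and almost everywhere uniqueness of the weak curl\<close>

lemma test_fieldsD:
  assumes "\<psi> \<in> test_fields"
  shows "Ck k \<psi>" "bounded {x. \<psi> x \<noteq> 0}"
  using assms closure_subset[of "{x. \<psi> x \<noteq> 0}"]
  by (auto simp: test_fields_def smooth_def intro: bounded_subset[OF compact_imp_bounded])

lemma test_fieldsI:
  assumes "\<And>k. Ck k \<psi>" "bounded {x. \<psi> x \<noteq> 0}"
  shows "\<psi> \<in> test_fields"
  using assms by (auto simp: test_fields_def smooth_def)

lemma locally_integrable_inner:
  assumes "locally_integrable g" "continuous_on UNIV \<psi>" "bounded {x. \<psi> x \<noteq> 0}"
  shows "integrable lebesgue (\<lambda>x. g x \<bullet> \<psi> x)"
proof -
  obtain B where B: "\<And>x. norm (\<psi> x) \<le> B" "B \<ge> 0"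
    using continuous_bounded_support_bounded assms by blast
  define C where "C = closure {x. \<psi> x \<noteq> 0}"
  have "integrable lebesgue (\<lambda>x. B * norm (indicator C x *\<^sub>R g x))"
    using assms by (intro integrable_mult_right integrable_norm)
      (auto simp: locally_integrable_def C_def set_integrable_def)
  then show ?thesis
  proof (rule Bochner_Integration.integrable_bound)
    have "\<psi> \<in> borel_measurable lebesgue"
      by (rule continuous_imp_borel_measurable_lebesgue[OF assms(2)])
    then show "(\<lambda>x. g x \<bullet> \<psi> x) \<in> borel_measurable lebesgue"
      using assms(1) by (auto simp: locally_integrable_def)
    have "norm (g x \<bullet> \<psi> x) \<le> norm (B * norm (indicator C x *\<^sub>R g x))" for x
    proof (cases "\<psi> x = 0")
      case False
      then have "x \<in> C"
        using closure_subset[of "{x. \<psi> x \<noteq> 0}"] by (auto simp: C_def)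
      then show ?thesis
        using B Cauchy_Schwarz_ineq2[of "g x" "\<psi> x"]
        by (simp add: abs_mult) (smt (verit) mult.commute mult_left_mono norm_ge_zero)
    qed (use B in auto)
    then show "AE x in lebesgue. norm (g x \<bullet> \<psi> x) \<le> norm (B * norm (indicator C x *\<^sub>R g x))"
      by simp
  qed
qed

lemma locally_integrable_diff:
  "locally_integrable f \<Longrightarrow> locally_integrable g \<Longrightarrow> locally_integrable (\<lambda>x. f x - g x)"
  by (auto simp: locally_integrable_def intro: set_integral_diff)

text \<open>Smooth cutoffs converge boundedly to the indicator of a box, so vanishing against test
  fields forces all box integrals to vanish, and these determine \<open>g\<close> almost
  everywhere.\<close>

lemma fundamental_lemma_variations:
  assumes g: "locally_integrable g"
    and zero: "\<And>\<psi>. \<psi> \<in> test_fields \<Longrightarrow> (LINT x|lebesgue. g x \<bullet> \<psi> x) = 0"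
  shows "AE x in lebesgue. g x = 0"
proof (rule AE_zero_if_box_integrals_zero)
  show C: "set_integrable lebesgue C g" if "compact C" for C
    using g that by (auto simp: locally_integrable_def)
  fix a b :: "real^3"
  have meas: "g \<in> borel_measurable lebesgue"
    using g by (simp add: locally_integrable_def)
  have cm: "cutoff a b n \<in> borel_measurable lebesgue" for n
    using smooth_cutoff[of a b n]
    by (intro continuous_imp_borel_measurable_lebesgue) (auto simp: smooth_def dest: spec[of _ 0])
  \<comment> \<open>Local integrability speaks of compact sets, hence the closure of the open box in
    the dominating function.\<close>
  have dom: "integrable lebesgue (\<lambda>x. norm (indicator (closure (box a b)) x *\<^sub>R g x))"
    using C[of "closure (box a b)"] unfolding set_integrable_def by (intro integrable_norm) auto
  have bnd: "norm (cutoff a b n x *\<^sub>R g x) \<le> norm (indicator (closure (box a b)) x *\<^sub>R g x)" for n x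
    using cutoff_bounds[of a b n x] cutoff_zero[of x a b n] closure_subset[of "box a b"]
    by (cases "x \<in> box a b") (auto simp: mult_left_le_one_le)
  have int: "integrable lebesgue (\<lambda>x. cutoff a b n x *\<^sub>R g x)" for n
    by (rule Bochner_Integration.integrable_bound[OF dom borel_measurable_scaleR[OF cm meas]])
      (use bnd in auto)
  \<comment> \<open>A vector integral is 0 if its inner product with each fixed \<open>e\<close> is;
    the cutoff times \<open>e\<close> is an admissible test field.\<close>
  have z: "(LINT x|lebesgue. cutoff a b n x *\<^sub>R g x) = 0" for n
  proof (rule all_zero_iff[THEN iffD1, rule_format])
    fix e
    have "(\<lambda>x. cutoff a b n x *\<^sub>R e) \<in> test_fields"
    proof (intro test_fieldsI Ck_linear_compose[OF bounded_linear_scaleR_left])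
      show "Ck k (cutoff a b n)" for k
        using smooth_cutoff[of a b n] by (simp add: smooth_def)
      show "bounded {x. cutoff a b n x *\<^sub>R e \<noteq> 0}"
        using cutoff_zero[of _ a b n] by (intro bounded_subset[OF bounded_box[of a b]]) auto
    qed
    from zero[OF this] have "(LINT x|lebesgue. (cutoff a b n x *\<^sub>R g x) \<bullet> e) = 0"
      by simp
    then show "(LINT x|lebesgue. cutoff a b n x *\<^sub>R g x) \<bullet> e = 0"
      by (subst (asm) integral_inner_left) (use int in auto)
  qed
  have "(\<lambda>n. LINT x|lebesgue. cutoff a b n x *\<^sub>R g x) \<longlonglongrightarrow> (LINT x|lebesgue. indicator (box a b) x *\<^sub>R g x)"
  proof (rule integral_dominated_convergence[OF _ _ dom])
    show "AE x in lebesgue. (\<lambda>n. cutoff a b n x *\<^sub>R g x) \<longlonglongrightarrow> indicator (box a b) x *\<^sub>R g x"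
      by (intro AE_I2 tendsto_scaleR cutoff_tendsto tendsto_const)
  qed (use bnd in \<open>auto intro!: borel_measurable_scaleR cm meas borel_measurable_indicator\<close>)
  then show "(LINT x:box a b|lebesgue. g x) = 0"
    by (simp add: z set_lebesgue_integral_def LIMSEQ_const_iff)
qed

lemma has_weak_curl_unique:
  assumes "has_weak_curl u g" "has_weak_curl u g'"
  shows "AE x in lebesgue. g x = g' x"
proof -
  have "AE x in lebesgue. g x - g' x = 0"
  proof (rule fundamental_lemma_variations)
    show "locally_integrable (\<lambda>x. g x - g' x)"
      using assms by (auto simp: has_weak_curl_def intro: locally_integrable_diff)
    fix \<psi> assume \<psi>: "\<psi> \<in> test_fields"
    then have "integrable lebesgue (\<lambda>x. g x \<bullet> \<psi> x)" "integrable lebesgue (\<lambda>x. g' x \<bullet> \<psi> x)"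
      using assms test_fieldsD(1)[OF \<psi>, of 0] test_fieldsD(2)[OF \<psi>] by (auto simp: has_weak_curl_def intro!: locally_integrable_inner)
    then show "(LINT x|lebesgue. (g x - g' x) \<bullet> \<psi> x) = 0"
      using assms \<psi> by (simp add: has_weak_curl_def inner_diff_left)
  qed
  then show ?thesis by simp
qed

section \<open>Rotations and the curl\<close>

text \<open>As a rewrite rule it turns \<open>transpose R *v x\<close> into \<open>x v* R\<close>, a
  form in which the cancellation rules for orthogonal matrices no longer match.\<close>

declare transpose_matrix_vector [simp del]

section \<open>Orthogonal maps and Lebesgue measure\<close>

lemma orthogonal_matrix_cancel:
  fixes R :: "real^'n^'n"
  assumes "orthogonal_matrix R"
  shows "transpose R *v (R *v x) = x" "R *v (transpose R *v x) = x"
  using assms by (simp_all add: orthogonal_matrix_def matrix_vector_mul_assoc)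

lemma orthogonal_matrix_inner:
  fixes R :: "real^'n^'n"
  assumes "orthogonal_matrix R"
  shows "(R *v x) \<bullet> (R *v y) = x \<bullet> y" "(transpose R *v x) \<bullet> y = x \<bullet> (R *v y)"
    "norm (R *v x) = norm x"
proof -
  show *: "(transpose R *v x) \<bullet> y = x \<bullet> (R *v y)" for x y
    by (metis dot_lmul_matrix vector_transpose_matrix transpose_matrix_vector)
  show **: "(R *v x) \<bullet> (R *v y) = x \<bullet> y" for x y
    using *[of "R *v x" y] by (simp add: orthogonal_matrix_cancel[OF assms])
  show "norm (R *v x) = norm x"
    by (simp add: norm_eq_sqrt_inner **)
qed

lemma det_orthogonal_square:
  fixes R :: "real^'n^'n"
  shows "orthogonal_matrix R \<Longrightarrow> det R * det R = 1"
  using det_orthogonal_matrix[of R] by auto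

text \<open>\<open>lborel\<close> is determined by its values on boxes. The preimage of a box under
  \<open>R\<close> is its image under the transpose, and orthogonal images keep Lebesgue
  measure.\<close>

lemma lborel_distr_orthogonal:
  fixes R :: "real^'n::{finite,wellorder}^'n::_"
  assumes R: "orthogonal_matrix R"
  shows "distr lborel borel ((*v) R) = lborel"
proof (rule lborel_eqI[symmetric])
  fix l u :: "real^'n::_"
  assume le: "\<And>b. b \<in> Basis \<Longrightarrow> l \<bullet> b \<le> u \<bullet> b"
  have meas: "(*v) R \<in> borel_measurable borel"
    by (intro borel_measurable_continuous_onI linear_continuous_on) simp
  have eq: "(*v) R -` box l u = (*v) (transpose R) ` box l u"
  proof (intro set_eqI iffI)
    fix x assume "x \<in> (*v) R -` box l u"
    then show "x \<in> (*v) (transpose R) ` box l u"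
      by (intro image_eqI[of _ _ "R *v x"]) (simp_all add: orthogonal_matrix_cancel[OF R])
  qed (auto simp: orthogonal_matrix_cancel[OF R])
  have "orthogonal_transformation ((*v) (transpose R))"
    using R by (simp add: orthogonal_transformation_matrix)
  then have "(*v) R -` box l u \<in> lmeasurable" "measure lebesgue ((*v) R -` box l u) = measure lebesgue (box l u)"
    unfolding eq by (auto simp: measurable_orthogonal_image measure_orthogonal_image)
  then have "emeasure lebesgue ((*v) R -` box l u) = emeasure lebesgue (box l u)"
    by (metis emeasure_eq_measure2 lmeasurable_box)
  moreover have "(*v) R -` box l u \<in> sets borel"
    using measurable_sets[OF meas, of "box l u"] by simp
  ultimately show "emeasure (distr lborel borel ((*v) R)) (box l u) = (\<Prod>b\<in>Basis. (u - l) \<bullet> b)"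
    using le meas by (simp add: emeasure_distr emeasure_lborel_box)
qed simp

text \<open>Measurability between completions needs preimages of null sets to be null, which Borel
  measurability does not give; it follows once the image measure is known to be
  \<open>lborel\<close>.\<close>

lemma
  fixes R :: "real^'n::{finite,wellorder}^'n::_"
  assumes R: "orthogonal_matrix R"
  shows lebesgue_measurable_orthogonal: "(*v) R \<in> lebesgue \<rightarrow>\<^sub>M lebesgue"
    and lebesgue_distr_orthogonal: "distr lebesgue lebesgue ((*v) R) = lebesgue"
proof -
  have meas: "(*v) R \<in> lborel \<rightarrow>\<^sub>M lborel"
    using borel_measurable_continuous_onI[OF linear_continuous_on[of "(*v) R" UNIV]] by simp
  have "distr lebesgue lborel ((*v) R) = distr lborel borel ((*v) R)"
    using meas by (simp add: distr_completion cong: distr_cong)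
  then have d: "distr lebesgue lborel ((*v) R) = lborel"
    using lborel_distr_orthogonal[OF R] by simp
  show "(*v) R \<in> lebesgue \<rightarrow>\<^sub>M lebesgue"
    using meas by (intro completion.measurable_completion2 measurable_completion) (simp_all add: d)
  show "distr lebesgue lebesgue ((*v) R) = lebesgue"
    using completion.completion_distr_eq[OF measurable_completion[OF meas]] by (simp add: d)
qed

text \<open>The integral formula holds under measurability alone: if \<open>f\<close> is not
  integrable, neither is its rotation, and both integrals are 0. So no integrability has to be
  checked when the equation for \<open>K\<close> or \<open>dJ\<close> is rotated.\<close>

lemma
  fixes R :: "real^'n::{finite,wellorder}^'n::_" and f :: "real^'n::_ \<Rightarrow> 'b::euclidean_space"
  assumes R: "orthogonal_matrix R"
  shows borel_measurable_rotated:
      "f \<in> borel_measurable lebesgue \<Longrightarrow> (\<lambda>x. f (R *v x)) \<in> borel_measurable lebesgue"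
    and integral_rotated:
      "f \<in> borel_measurable lebesgue \<Longrightarrow> (LINT x|lebesgue. f (R *v x)) = (LINT x|lebesgue. f x)"
    and integrable_rotated:
      "integrable lebesgue f \<Longrightarrow> integrable lebesgue (\<lambda>x. f (R *v x))"
proof -
  note m = lebesgue_measurable_orthogonal[OF R] and d = lebesgue_distr_orthogonal[OF R]
  show "(\<lambda>x. f (R *v x)) \<in> borel_measurable lebesgue" if "f \<in> borel_measurable lebesgue"
    using measurable_compose[OF m that] by simp
  show "(LINT x|lebesgue. f (R *v x)) = (LINT x|lebesgue. f x)" if "f \<in> borel_measurable lebesgue"
    using integral_distr[OF m that] by (simp add: d)
  show "integrable lebesgue (\<lambda>x. f (R *v x))" if "integrable lebesgue f"
    using integrable_distr[OF m, of f] that by (simp add: d)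
qed

lemma AE_rotated:
  fixes R :: "real^'n::{finite,wellorder}^'n::_"
  assumes R: "orthogonal_matrix R" and "AE x in lebesgue. P x"
  shows "AE x in lebesgue. P (R *v x)"
  by (rule AE_distrD[OF lebesgue_measurable_orthogonal[OF R]])
    (simp only: lebesgue_distr_orthogonal[OF R] assms(2))

text \<open>The formula nabla x f, with each partial derivative crossed from the left by its basis
  vector. Continuity, support, differences and the product rule of the curl are read off from it
  without components.\<close>

lemma curl_eq_sum_cross:
  "curl f x = (\<Sum>i\<in>UNIV. cross3 (axis i 1) (frechet_derivative f (at x) (axis i 1)))"
  by (simp add: vec_eq_iff forall_3 sum_3 curl_def pd_def cross3_def axis_def)

lemma frechet_derivative_component:
  assumes "f differentiable (at x)"
  shows "frechet_derivative f (at x) h $ j = (\<Sum>i\<in>UNIV. h $ i * pd f i j x)"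
proof -
  have lin: "linear (frechet_derivative f (at x))"
    using assms linear_frechet_derivative by blast
  have "frechet_derivative f (at x) h
      = frechet_derivative f (at x) (\<Sum>i\<in>UNIV. h $ i *\<^sub>R axis i 1)"
    using basis_expansion[of h] by (simp add: scalar_mult_eq_scaleR)
  then show ?thesis
    by (simp add: linear_sum[OF lin] linear_cmul[OF lin] pd_def)
qed

text \<open>The curl encodes the antisymmetric part of the derivative. With \<open>h\<close> and
  \<open>k\<close> arbitrary, this identity can be rotated as it stands.\<close>

lemma curl_inner_cross:
  assumes "f differentiable (at x)"
  shows "curl f x \<bullet> cross3 h k
    = frechet_derivative f (at x) h \<bullet> k - frechet_derivative f (at x) k \<bullet> h"
  by (simp add: inner_vec_def frechet_derivative_component[OF assms] sum_3 curl_def cross_components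
      algebra_simps)

section \<open>Transformation of curl and divergence under orthogonal maps\<close>

definition pullback :: "real^3^3 \<Rightarrow> (real^3 \<Rightarrow> real^3) \<Rightarrow> real^3 \<Rightarrow> real^3" where
  "pullback R f x = transpose R *v f (R *v x)"

text \<open>The factor \<open>det R\<close> makes the action commute with the curl for reflections too.\<close>

definition pseudo_pullback :: "real^3^3 \<Rightarrow> (real^3 \<Rightarrow> real^3) \<Rightarrow> real^3 \<Rightarrow> real^3" where
  "pseudo_pullback R u x = det R *\<^sub>R pullback R u x"

lemma pullback_transpose:
  assumes "orthogonal_matrix R"
  shows "pullback R (pullback (transpose R) f) = f"
  by (simp add: pullback_def fun_eq_iff orthogonal_matrix_cancel[OF assms])

lemma pseudo_pullback_transpose:
  assumes "orthogonal_matrix R"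
  shows "pseudo_pullback R (pseudo_pullback (transpose R) f) = f"
proof
  fix x
  have "pseudo_pullback R (pseudo_pullback (transpose R) f) x
      = (det R * det R) *\<^sub>R pullback R (pullback (transpose R) f) x"
    by (simp add: pseudo_pullback_def pullback_def matrix_vector_mult_scaleR)
  then show "pseudo_pullback R (pseudo_pullback (transpose R) f) x = f x"
    by (simp only: pullback_transpose[OF assms] det_orthogonal_square[OF assms] scaleR_one)
qed

lemma bounded_linear_pseudo:
  "bounded_linear (\<lambda>y. det R *\<^sub>R (transpose R *v y))" for R :: "real^3^3"
  by (intro bounded_linear_const_scaleR matrix_vector_mul_bounded_linear)

lemma has_derivative_pseudo_pullback:
  assumes "f differentiable (at (R *v x))"
  shows "(pseudo_pullback R f has_derivative
    (\<lambda>h. det R *\<^sub>R (transpose R *v frechet_derivative f (at (R *v x)) (R *v h)))) (at x)"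
proof -
  have "((*v) R has_derivative (*v) R) (at x)"
    by (intro bounded_linear_imp_has_derivative) simp
  from has_derivative_compose[OF this] assms
  have "((\<lambda>x. f (R *v x)) has_derivative (\<lambda>h. frechet_derivative f (at (R *v x)) (R *v h))) (at x)"
    by (simp add: frechet_derivative_works)
  from bounded_linear.has_derivative[OF bounded_linear_pseudo this]
  show ?thesis
    by (simp add: pseudo_pullback_def[abs_def] pullback_def)
qed

lemma Ck_pseudo_pullback: "Ck k f \<Longrightarrow> Ck k (pseudo_pullback R f)"
  using Ck_linear_compose[OF bounded_linear_pseudo, of k "\<lambda>x. f (R *v x)" R]
    Ck_compose_affine[of "(*v) R" k f 0]
  by (simp add: pseudo_pullback_def[abs_def] pullback_def)

text \<open>Both sides are tested against cross products. The determinant from the rotation of a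
  cross product meets the determinant built into the action.\<close>

lemma curl_pseudo_pullback:
  assumes R: "orthogonal_matrix R" and f: "f differentiable (at (R *v x))"
  shows "curl (pseudo_pullback R f) x = pullback R (curl f) x"
proof -
  note der = has_derivative_pseudo_pullback[OF f]
  have fd: "frechet_derivative (pseudo_pullback R f) (at x)
      = (\<lambda>h. det R *\<^sub>R (transpose R *v frechet_derivative f (at (R *v x)) (R *v h)))"
    using der frechet_derivative_at by metis
  have diff: "pseudo_pullback R f differentiable (at x)"
    using der by (auto simp: differentiable_def)
  have eq: "curl (pseudo_pullback R f) x \<bullet> cross3 h k = pullback R (curl f) x \<bullet> cross3 h k" for h k
  proof -
    have "pullback R (curl f) x \<bullet> cross3 h k = curl f (R *v x) \<bullet> (R *v cross3 h k)"
      by (simp add: pullback_def orthogonal_matrix_inner[OF R])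
    \<comment> \<open>The rule for the cross product of rotated vectors has the determinant on the
      other side; multiplication by \<open>det R\<close> moves it, as its square is 1.\<close>
    also have "R *v cross3 h k = det R *\<^sub>R cross3 (R *v h) (R *v k)"
      using det_orthogonal_square[OF R] by (simp add: cross_orthogonal_matrix[OF R])
    finally show ?thesis
      by (simp add: curl_inner_cross[OF diff] curl_inner_cross[OF f] fd orthogonal_matrix_inner[OF R]
          algebra_simps)
  qed
  \<comment> \<open>Cross products of pairs of basis vectors are the basis vectors, so testing
    against cross products gives every component.\<close>
  have "curl (pseudo_pullback R f) x $ i = pullback R (curl f) x $ i" for i
    using eq[of "axis 1 1" "axis 2 1"] eq[of "axis 2 1" "axis 3 1"] eq[of "axis 3 1" "axis 1 1"] exhaust_3[of i]
    by (auto simp: cross_basis inner_axis)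
  then show ?thesis
    by (simp add: vec_eq_iff)
qed

text \<open>The divergence is the trace of the derivative, and the trace is unchanged under
  conjugation by \<open>R\<close>. This keeps solenoidal fields solenoidal.\<close>

lemma div3_pseudo_pullback:
  assumes R: "orthogonal_matrix R" and f: "f differentiable (at (R *v x))"
  shows "div3 (pseudo_pullback R f) x = det R * div3 f (R *v x)"
proof -
  define M where "M = matrix (frechet_derivative f (at (R *v x)))"
  have fd: "frechet_derivative (pseudo_pullback R f) (at x)
      = (\<lambda>h. det R *\<^sub>R (transpose R *v frechet_derivative f (at (R *v x)) (R *v h)))"
    using has_derivative_pseudo_pullback[OF f] frechet_derivative_at by metis
  have M: "frechet_derivative f (at (R *v x)) h = M *v h" for h
    unfolding M_def using linear_frechet_derivative[OF f] by (simp add: matrix_works)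
  have "div3 (pseudo_pullback R f) x = det R * trace (transpose R ** M ** R)"
    by (simp add: div3_def pd_def fd M trace_def matrix_vector_mul_assoc matrix_mul_assoc
        matrix_vector_mult_basis column_def sum_distrib_left)
  also have "trace (transpose R ** M ** R) = trace (R ** (transpose R ** M))"
    by (rule trace_mul_sym)
  also have "R ** (transpose R ** M) = M"
    using R by (simp add: matrix_mul_assoc orthogonal_matrix_def)
  also have "trace M = div3 f (R *v x)"
    by (simp add: div3_def pd_def M trace_def matrix_vector_mult_basis column_def)
  finally show ?thesis .
qed

lemma bounded_support_pseudo_pullback:
  assumes R: "orthogonal_matrix R" and "bounded {x. f x \<noteq> 0}"
  shows "bounded {x. pseudo_pullback R f x \<noteq> 0}"
proof -
  have "{x. pseudo_pullback R f x \<noteq> 0} \<subseteq> (*v) (transpose R) ` {x. f x \<noteq> 0}"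
  proof
    fix x assume "x \<in> {x. pseudo_pullback R f x \<noteq> 0}"
    then have "f (R *v x) \<noteq> 0"
      by (auto simp: pseudo_pullback_def pullback_def)
    then show "x \<in> (*v) (transpose R) ` {x. f x \<noteq> 0}"
      by (intro image_eqI[of _ _ "R *v x"]) (simp_all add: orthogonal_matrix_cancel[OF R])
  qed
  moreover have "bounded ((*v) (transpose R) ` {x. f x \<noteq> 0})"
    by (intro bounded_linear_image assms) simp
  ultimately show ?thesis
    by (rule bounded_subset[rotated])
qed

lemma test_fields_pseudo_pullback:
  assumes "orthogonal_matrix R" "\<psi> \<in> test_fields"
  shows "pseudo_pullback R \<psi> \<in> test_fields"
  using assms test_fieldsD[OF assms(2)]
  by (intro test_fieldsI Ck_pseudo_pullback bounded_support_pseudo_pullback) auto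

lemma test_fields_differentiable: "\<psi> \<in> test_fields \<Longrightarrow> \<psi> differentiable (at x)"
  using test_fieldsD(1)[of \<psi> 1] by simp

lemma solenoidal_tests_pseudo_pullback:
  assumes "orthogonal_matrix R" "\<phi> \<in> solenoidal_tests"
  shows "pseudo_pullback R \<phi> \<in> solenoidal_tests"
  using assms
  by (auto simp: solenoidal_tests_def test_fields_pseudo_pullback div3_pseudo_pullback test_fields_differentiable)

section \<open>Integration by parts for the curl\<close>

lemma continuous_on_curl:
  assumes "Ck 1 f"
  shows "continuous_on UNIV (curl f)"
  unfolding curl_eq_sum_cross[abs_def]
  using assms by (intro continuous_on_sum continuous_on_cross continuous_on_const) simp

lemma bounded_support_curl:
  assumes "bounded {x. f x \<noteq> 0}"
  shows "bounded {x. curl f x \<noteq> 0}"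
proof (rule bounded_subset)
  show "bounded (closure {x. f x \<noteq> 0})"
    by (rule bounded_closure[OF assms])
  show "{x. curl f x \<noteq> 0} \<subseteq> closure {x. f x \<noteq> 0}"
    using frechet_derivative_eq_0_outside_support[of _ f] by (fastforce simp: curl_eq_sum_cross)
qed

text \<open>The auxiliary \<open>s i\<close> is the i-th component of f x h, so this is div(f x h) =
  curl f . h - f . curl h integrated. Bounded support is asked of \<open>h\<close> only, so that
  \<open>f\<close> may contain an additive constant.\<close>

lemma integral_by_parts_curl:
  assumes f: "Ck 1 f" and h: "Ck 1 h" "bounded {x. h x \<noteq> 0}"
  shows "(LINT x|lebesgue. f x \<bullet> curl h x) = (LINT x|lebesgue. curl f x \<bullet> h x)"
proof -
  define s where "s i x = cross3 (axis i 1) (f x) \<bullet> h x" for i x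
  have blin: "bounded_bilinear (\<lambda>a b. cross3 (axis i 1) a \<bullet> b)" for i :: 3
  proof (rule bounded_bilinear.comp1[OF bounded_bilinear_inner])
    show "bounded_linear (cross3 (axis i 1))"
      using bilinear_cross by (simp add: bilinear_def linear_conv_bounded_linear)
  qed
  have Cs: "Ck 1 (s i)" for i
    unfolding s_def[abs_def] by (rule Ck_bilinear[OF blin f h(1)])
  have supp: "bounded {x. s i x \<noteq> 0}" for i
    by (rule bounded_subset[OF h(2)]) (auto simp: s_def)
  have ds: "frechet_derivative (s i) (at x) v = cross3 (axis i 1) (f x) \<bullet> frechet_derivative h (at x) v
      + cross3 (axis i 1) (frechet_derivative f (at x) v) \<bullet> h x" for i x v
  proof -
    have "(s i has_derivative (\<lambda>v. cross3 (axis i 1) (f x) \<bullet> frechet_derivative h (at x) v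
      + cross3 (axis i 1) (frechet_derivative f (at x) v) \<bullet> h x)) (at x)"
      unfolding s_def[abs_def] using f h
      by (intro bounded_bilinear.FDERIV[OF blin] Ck_has_derivative[of 0]) auto
    from fun_cong[OF frechet_derivative_at[OF this], of v] show ?thesis
      by simp
  qed
  have "cross3 e a \<bullet> b = - (a \<bullet> cross3 e b)" for e a b
    by (simp add: cross3_simps)
  then have div: "curl f x \<bullet> h x - f x \<bullet> curl h x = (\<Sum>i\<in>UNIV. frechet_derivative (s i) (at x) (axis i 1))" for x
    by (simp add: ds curl_eq_sum_cross inner_sum_left inner_sum_right sum.distrib sum_negf sum_subtractf)
  have cont: "continuous_on UNIV f" "continuous_on UNIV h" "continuous_on UNIV (curl f)" "continuous_on UNIV (curl h)"
    using Ck_SucD[of 0] f h continuous_on_curl by auto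
  have int: "integrable lebesgue (\<lambda>x. f x \<bullet> curl h x)" "integrable lebesgue (\<lambda>x. curl f x \<bullet> h x)"
  proof -
    have "bounded {x. f x \<bullet> curl h x \<noteq> 0}"
      by (rule bounded_subset[OF bounded_support_curl[OF h(2)]]) force
    then show "integrable lebesgue (\<lambda>x. f x \<bullet> curl h x)"
      by (intro integrable_continuous_bounded_support continuous_on_inner cont)
    have "bounded {x. curl f x \<bullet> h x \<noteq> 0}"
      by (rule bounded_subset[OF h(2)]) force
    then show "integrable lebesgue (\<lambda>x. curl f x \<bullet> h x)"
      by (intro integrable_continuous_bounded_support continuous_on_inner cont)
  qed
  have "(LINT x|lebesgue. curl f x \<bullet> h x) - (LINT x|lebesgue. f x \<bullet> curl h x)
      = (LINT x|lebesgue. (\<Sum>i\<in>UNIV. frechet_derivative (s i) (at x) (axis i 1)))"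
    using int by (simp flip: div)
  also have "\<dots> = (\<Sum>i\<in>UNIV. (LINT x|lebesgue. frechet_derivative (s i) (at x) (axis i 1)))"
    using Cs by (intro Bochner_Integration.integral_sum integrable_continuous_bounded_support
        bounded_support_frechet_derivative supp) simp
  also have "\<dots> = 0"
    using integral_directional_derivative[OF Cs supp] by simp
  finally show ?thesis
    by simp
qed

section \<open>Square integrability of the weak curl\<close>

lemma integrable_norm_diff_square:
  fixes f g :: "'a \<Rightarrow> 'b::euclidean_space"
  assumes [measurable]: "f \<in> borel_measurable M" "g \<in> borel_measurable M"
    and "integrable M (\<lambda>x. (norm (f x))\<^sup>2)" "integrable M (\<lambda>x. (norm (g x))\<^sup>2)"
  shows "integrable M (\<lambda>x. (norm (f x - g x))\<^sup>2)"
proof (rule Bochner_Integration.integrable_bound)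
  show "integrable M (\<lambda>x. 2 * (norm (f x))\<^sup>2 + 2 * (norm (g x))\<^sup>2)"
    using assms by simp
  have "(norm (f x - g x))\<^sup>2 \<le> 2 * (norm (f x))\<^sup>2 + 2 * (norm (g x))\<^sup>2" for x
  proof -
    have "(norm (f x - g x))\<^sup>2 \<le> (norm (f x) + norm (g x))\<^sup>2"
      by (intro power_mono norm_triangle_ineq4) simp
    also have "\<dots> \<le> 2 * (norm (f x))\<^sup>2 + 2 * (norm (g x))\<^sup>2"
      using sum_squares_bound[of "norm (f x)" "norm (g x)"] by (simp add: power2_sum)
    finally show ?thesis .
  qed
  then show "AE x in M. norm ((norm (f x - g x))\<^sup>2) \<le> norm (2 * (norm (f x))\<^sup>2 + 2 * (norm (g x))\<^sup>2)"
    by simp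
qed measurable

text \<open>The Riesz-Fischer argument: a rapidly convergent subsequence has an almost everywhere
  limit, and Fatou's lemma turns the Cauchy bound into convergence in L2 of the whole
  sequence.\<close>

lemma L2_complete:
  fixes f :: "nat \<Rightarrow> 'a \<Rightarrow> 'b::euclidean_space"
  assumes [measurable]: "\<And>n. f n \<in> borel_measurable M"
    and sq: "\<And>n. integrable M (\<lambda>x. (norm (f n x))\<^sup>2)"
    and Cauchy: "\<And>e. e > 0 \<Longrightarrow> \<exists>N. \<forall>m\<ge>N. \<forall>n\<ge>N. (LINT x|M. (norm (f m x - f n x))\<^sup>2) < e"
  obtains g where "g \<in> borel_measurable M" "integrable M (\<lambda>x. (norm (g x))\<^sup>2)"
    "(\<lambda>n. LINT x|M. (norm (f n x - g x))\<^sup>2) \<longlonglongrightarrow> 0"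
proof -
  have d: "(\<integral>\<^sup>+x. ennreal ((norm (f m x - f n x))\<^sup>2) \<partial>M) = ennreal (LINT x|M. (norm (f m x - f n x))\<^sup>2)" for m n
    by (intro nn_integral_eq_integral integrable_norm_diff_square sq) auto
  have "\<exists>N. \<forall>m\<ge>N. \<forall>n\<ge>N. (LINT x|M. (norm (f m x - f n x))\<^sup>2) < (1 / 4) ^ k" for k
    by (rule Cauchy) simp
  then have "\<exists>N. \<forall>k. \<forall>m\<ge>N k. \<forall>n\<ge>N k. (LINT x|M. (norm (f m x - f n x))\<^sup>2) < (1 / 4) ^ k"
    by (intro choice allI)
  then obtain N where N: "\<And>k m n. m \<ge> N k \<Longrightarrow> n \<ge> N k \<Longrightarrow> (LINT x|M. (norm (f m x - f n x))\<^sup>2) < (1 / 4) ^ k"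
    by blast
  \<comment> \<open>Adding up all thresholds makes both \<open>r k\<close> and
    \<open>r (Suc k)\<close> at least \<open>N k\<close>; the summand \<open>k\<close> makes the
    subsequence tend to infinity, as the Fatou step requires.\<close>
  define r where "r k = k + (\<Sum>i\<le>k. N i)" for k
  have rN: "N k \<le> r k" "N k \<le> r (Suc k)" "k \<le> r k" for k
  proof -
    have "N k \<le> sum N {..k}"
      by (rule member_le_sum) auto
    then show "N k \<le> r k" "N k \<le> r (Suc k)" "k \<le> r k"
      by (simp_all add: r_def)
  qed
  define h where "h k x = f (r (Suc k)) x - f (r k) x" for k x
  have [measurable]: "h k \<in> borel_measurable M" for k
    unfolding h_def[abs_def] by measurable
  \<comment> \<open>The squared distance is below 4^(-k), which leaves room for a weight 2^k with a
    summable result. The weight is what later yields summability of the norms themselves rather than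
    of their squares.\<close>
  have "(\<integral>\<^sup>+x. (\<Sum>k. ennreal (2 ^ k * (norm (h k x))\<^sup>2)) \<partial>M) = (\<Sum>k. \<integral>\<^sup>+x. ennreal (2 ^ k * (norm (h k x))\<^sup>2) \<partial>M)"
    by (rule nn_integral_suminf) measurable
  also have "\<dots> \<le> (\<Sum>k. ennreal ((1 / 2) ^ k))"
  proof (rule suminf_le)
    fix k
    have "(\<integral>\<^sup>+x. ennreal (2 ^ k * (norm (h k x))\<^sup>2) \<partial>M) = ennreal (2 ^ k) * (\<integral>\<^sup>+x. ennreal ((norm (h k x))\<^sup>2) \<partial>M)"
      by (simp add: ennreal_mult nn_integral_cmult)
    also have "\<dots> \<le> ennreal (2 ^ k) * ennreal ((1 / 4) ^ k)"
      using N[OF rN(2) rN(1), of k] by (intro mult_left_mono) (auto simp: h_def d intro!: ennreal_leI)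
    also have "\<dots> = ennreal ((1 / 2) ^ k)"
      by (simp flip: ennreal_mult power_mult_distrib)
    finally show "(\<integral>\<^sup>+x. ennreal (2 ^ k * (norm (h k x))\<^sup>2) \<partial>M) \<le> ennreal ((1 / 2) ^ k)" .
  qed auto
  also have "\<dots> < \<infinity>"
    by (subst suminf_ennreal2) (auto intro: summable_geometric)
  finally have "AE x in M. (\<Sum>k. ennreal (2 ^ k * (norm (h k x))\<^sup>2)) \<noteq> \<infinity>"
    by (intro nn_integral_PInf_AE) auto
  then have conv: "AE x in M. convergent (\<lambda>k. f (r k) x)"
  proof eventually_elim
    case (elim x)
    then have "summable (\<lambda>k. 2 ^ k * (norm (h k x))\<^sup>2)"
      by (intro summable_suminf_not_top) auto
    then have "summable (\<lambda>k. 2 ^ k * (norm (h k x))\<^sup>2 + (1 / 2) ^ k)"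
      by (intro summable_add summable_geometric) auto
    then have "summable (\<lambda>k. h k x)"
    proof (rule summable_comparison_test'[where N = 0])
      fix k
      define q :: real where "q = (1 / 2) ^ k"
      have pq: "2 ^ k * q = 1"
        by (simp add: q_def flip: power_mult_distrib)
      \<comment> \<open>The arithmetic-geometric mean inequality with q = 2^(-k): multiplied by 2^k
        it bounds the norm by the weighted square plus 2^(-k), both summable.\<close>
      have "2 ^ k * (2 * q * norm (h k x)) \<le> 2 ^ k * (q\<^sup>2 + (norm (h k x))\<^sup>2)"
        by (intro mult_left_mono sum_squares_bound) simp
      moreover have "2 ^ k * (2 * q * norm (h k x)) = 2 * (2 ^ k * q) * norm (h k x)"
        "2 ^ k * (q\<^sup>2 + (norm (h k x))\<^sup>2) = (2 ^ k * q) * q + 2 ^ k * (norm (h k x))\<^sup>2"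
        by (simp_all add: power2_eq_square algebra_simps)
      ultimately have "2 * (2 ^ k * q) * norm (h k x) \<le> (2 ^ k * q) * q + 2 ^ k * (norm (h k x))\<^sup>2"
        by (simp only:)
      then have "2 * norm (h k x) \<le> 2 ^ k * (norm (h k x))\<^sup>2 + (1 / 2) ^ k"
        unfolding pq by (simp add: q_def)
      then show "norm (h k x) \<le> 2 ^ k * (norm (h k x))\<^sup>2 + (1 / 2) ^ k"
        using norm_ge_zero[of "h k x"] by linarith
    qed
    then have "convergent (\<lambda>k. \<Sum>i<k. h i x)"
      by (simp add: summable_iff_convergent)
    then have "convergent (\<lambda>k. (\<Sum>i<k. h i x) + f (r 0) x)"
      by (intro convergent_add convergent_const)
    then show ?case
      using sum_lessThan_telescope[of "\<lambda>k. f (r k) x"] by (simp add: h_def)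
  qed
  define g where "g x = lim (\<lambda>k. f (r k) x)" for x
  have gm [measurable]: "g \<in> borel_measurable M"
    unfolding g_def[abs_def] by measurable
  have fg: "(\<integral>\<^sup>+x. ennreal ((norm (f n x - g x))\<^sup>2) \<partial>M) \<le> ennreal e"
    if "\<forall>m\<ge>K. \<forall>n\<ge>K. (LINT x|M. (norm (f m x - f n x))\<^sup>2) < e" "n \<ge> K" for K n e
  proof -
    have "AE x in M. ennreal ((norm (f n x - g x))\<^sup>2) = liminf (\<lambda>k. ennreal ((norm (f n x - f (r k) x))\<^sup>2))"
      using conv
    proof eventually_elim
      case (elim x)
      then have "(\<lambda>k. f (r k) x) \<longlonglongrightarrow> g x"
        by (simp add: g_def convergent_LIMSEQ_iff)
      then have "(\<lambda>k. ennreal ((norm (f n x - f (r k) x))\<^sup>2)) \<longlonglongrightarrow> ennreal ((norm (f n x - g x))\<^sup>2)"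
        by (intro tendsto_intros)
      from lim_imp_Liminf[OF _ this] show ?case
        by simp
    qed
    then have "(\<integral>\<^sup>+x. ennreal ((norm (f n x - g x))\<^sup>2) \<partial>M)
        = (\<integral>\<^sup>+x. liminf (\<lambda>k. ennreal ((norm (f n x - f (r k) x))\<^sup>2)) \<partial>M)"
      by (rule nn_integral_cong_AE)
    also have "\<dots> \<le> liminf (\<lambda>k. \<integral>\<^sup>+x. ennreal ((norm (f n x - f (r k) x))\<^sup>2) \<partial>M)"
      by (rule nn_integral_liminf) measurable
    also have "\<dots> \<le> liminf (\<lambda>k::nat. ennreal e)"
    proof (rule Liminf_mono)
      show "\<forall>\<^sub>F k in sequentially. (\<integral>\<^sup>+x. ennreal ((norm (f n x - f (r k) x))\<^sup>2) \<partial>M) \<le> ennreal e"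
        using eventually_ge_at_top[of K]
      proof eventually_elim
        case (elim k)
        then have "r k \<ge> K"
          using rN(3)[of k] by linarith
        then have "(LINT x|M. (norm (f n x - f (r k) x))\<^sup>2) < e"
          using that by blast
        then show ?case
          by (simp add: d ennreal_leI)
      qed
    qed
    also have "\<dots> = ennreal e"
      by (simp add: Liminf_const)
    finally show ?thesis .
  qed
  have fgi: "integrable M (\<lambda>x. (norm (f n x - g x))\<^sup>2) \<and> (LINT x|M. (norm (f n x - g x))\<^sup>2) \<le> e"
    if "\<forall>m\<ge>K. \<forall>n\<ge>K. (LINT x|M. (norm (f m x - f n x))\<^sup>2) < e" "n \<ge> K" "e > 0" for K n e
  proof -
    have i: "integrable M (\<lambda>x. (norm (f n x - g x))\<^sup>2)"
      using fg[OF that(1,2)] by (intro integrableI_nonneg) (auto simp: le_less_trans)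
    moreover have "ennreal (LINT x|M. (norm (f n x - g x))\<^sup>2) \<le> ennreal e"
      using fg[OF that(1,2)] nn_integral_eq_integral[OF i] by simp
    ultimately show ?thesis
      using that(3) by simp
  qed
  obtain K where K: "\<forall>m\<ge>K. \<forall>n\<ge>K. (LINT x|M. (norm (f m x - f n x))\<^sup>2) < 1"
    using Cauchy[of 1] by auto
  \<comment> \<open>Square integrability of \<open>g\<close> comes from g = f K - (f K - g), a
    difference of two square integrable functions.\<close>
  have "integrable M (\<lambda>x. (norm (f K x - (f K x - g x)))\<^sup>2)"
    using fgi[OF K, of K] sq[of K] by (intro integrable_norm_diff_square[of "f K" M "\<lambda>x. f K x - g x"]) auto
  then have "integrable M (\<lambda>x. (norm (g x))\<^sup>2)"
    by simp
  moreover have "(\<lambda>n. LINT x|M. (norm (f n x - g x))\<^sup>2) \<longlonglongrightarrow> 0"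
  proof (rule LIMSEQ_I)
    fix e :: real assume "e > 0"
    then obtain K where K: "\<forall>m\<ge>K. \<forall>n\<ge>K. (LINT x|M. (norm (f m x - f n x))\<^sup>2) < e / 2"
      using Cauchy[of "e / 2"] by auto
    have "norm ((LINT x|M. (norm (f n x - g x))\<^sup>2) - 0) < e" if "n \<ge> K" for n
      using fgi[OF K that] \<open>e > 0\<close> by (simp add: integral_nonneg_AE)
    then show "\<exists>K. \<forall>n\<ge>K. norm ((LINT x|M. (norm (f n x - g x))\<^sup>2) - 0) < e"
      by blast
  qed
  ultimately show ?thesis
    by (rule that[OF gm])
qed

lemma set_integrable_const_compact:
  fixes C :: "'a::euclidean_space set" and c :: real
  assumes "compact C"
  shows "set_integrable lebesgue C (\<lambda>_. c)"
proof -
  have "integrable lebesgue (\<lambda>x. indicator C x *\<^sub>R c)"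
    using assms lmeasurable_compact[OF assms]
    by (intro integrable_scaleR_left integrable_real_indicator) (auto simp: fmeasurable_def)
  then show ?thesis
    by (simp add: set_integrable_def)
qed

text \<open>On a compact set, which has finite measure, |u| is dominated by 1 + |u|^2.\<close>

lemma locally_integrable_if_square_integrable:
  assumes m: "u \<in> borel_measurable lebesgue"
    and sq: "\<And>C. compact C \<Longrightarrow> set_integrable lebesgue C (\<lambda>x. (norm (u x))\<^sup>2)"
  shows "locally_integrable u"
  unfolding locally_integrable_def
proof (intro conjI allI impI m)
  fix C :: "(real^3) set" assume C: "compact C"
  then have Cm: "C \<in> sets lebesgue"
    using lmeasurable_compact fmeasurableD by blast
  have "set_integrable lebesgue C (\<lambda>x. 1 + (norm (u x))\<^sup>2)"
    using sq[OF C] set_integrable_const_compact[OF C] by (intro set_integral_add)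
  then have "integrable lebesgue (\<lambda>x. indicator C x *\<^sub>R (1 + (norm (u x))\<^sup>2))"
    by (simp add: set_integrable_def)
  then show "set_integrable lebesgue C u"
    unfolding set_integrable_def
  proof (rule Bochner_Integration.integrable_bound)
    show "(\<lambda>x. indicat_real C x *\<^sub>R u x) \<in> borel_measurable lebesgue"
      using m Cm by (intro borel_measurable_scaleR borel_measurable_indicator)
    have "norm (u x) \<le> 1 + (norm (u x))\<^sup>2" for x
    proof -
      have "2 * norm (u x) \<le> 1 + (norm (u x))\<^sup>2"
        using sum_squares_bound[of 1 "norm (u x)"] by simp
      then show ?thesis
        using norm_ge_zero[of "u x"] by linarith
    qed
    then show "AE x in lebesgue. norm (indicat_real C x *\<^sub>R u x)
        \<le> norm (indicat_real C x *\<^sub>R (1 + (norm (u x))\<^sup>2))"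
      by (auto simp: indicator_def intro!: AE_I2)
  qed
qed

text \<open>Young's inequality with a free weight \<delta> takes the place of the Cauchy-Schwarz
  inequality for integrals. The set \<open>C\<close> leaves room for two uses: a compact support for
  the potentials, which converge only locally, and the whole space for their curls.\<close>

lemma tendsto_integral_inner_L2:
  fixes w :: "nat \<Rightarrow> 'a::euclidean_space \<Rightarrow> 'b::euclidean_space"
  assumes sq: "\<And>n. set_integrable lebesgue C (\<lambda>x. (norm (w n x - u x))\<^sup>2)"
    and lim: "(\<lambda>n. LINT x:C|lebesgue. (norm (w n x - u x))\<^sup>2) \<longlonglongrightarrow> 0"
    and h: "continuous_on UNIV h" "bounded {x. h x \<noteq> 0}" "{x. h x \<noteq> 0} \<subseteq> C"
    and int: "\<And>n. integrable lebesgue (\<lambda>x. w n x \<bullet> h x)" "integrable lebesgue (\<lambda>x. u x \<bullet> h x)"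
  shows "(\<lambda>n. LINT x|lebesgue. w n x \<bullet> h x) \<longlonglongrightarrow> (LINT x|lebesgue. u x \<bullet> h x)"
proof (rule LIMSEQ_I)
  fix e :: real assume e: "e > 0"
  define H where "H = (LINT x|lebesgue. (norm (h x))\<^sup>2)"
  define I where "I n = (LINT x:C|lebesgue. (norm (w n x - u x))\<^sup>2)" for n
  \<comment> \<open>The weight makes \<delta> \<open>* H\<close> at most \<open>e\<close>, while the
    other term falls below \<open>e\<close> for large \<open>n\<close>; half their sum is then below
    \<open>e\<close>. The added 1 covers \<open>H = 0\<close>.\<close>
  define \<delta> where "\<delta> = e / (H + 1)"
  have Hi: "integrable lebesgue (\<lambda>x. (norm (h x))\<^sup>2)"
    using bounded_subset[OF h(2), of "{x. (norm (h x))\<^sup>2 \<noteq> 0}"]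
    by (intro integrable_continuous_bounded_support continuous_intros h(1)) auto
  have H: "H \<ge> 0"
    by (simp add: H_def)
  have \<delta>: "\<delta> > 0"
    using e H by (simp add: \<delta>_def)
  have bound: "\<bar>(LINT x|lebesgue. w n x \<bullet> h x) - (LINT x|lebesgue. u x \<bullet> h x)\<bar> \<le> (I n / \<delta> + \<delta> * H) / 2" for n
  proof -
    define b where "b x = (indicator C x *\<^sub>R (norm (w n x - u x))\<^sup>2 / \<delta> + \<delta> * (norm (h x))\<^sup>2) / 2" for x
    have bi: "integrable lebesgue b"
      using sq[of n] Hi by (simp add: b_def[abs_def] set_integrable_def)
    have pt: "\<bar>(w n x - u x) \<bullet> h x\<bar> \<le> b x" for x
    proof (cases "h x = 0")
      case True
      then show ?thesis using \<delta> by (simp add: b_def)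
    next
      case False
      then have "x \<in> C" using h(3) by auto
      define p where "p = norm (w n x - u x)"
      have "\<bar>(w n x - u x) \<bullet> h x\<bar> \<le> p * norm (h x)"
        unfolding p_def by (rule Cauchy_Schwarz_ineq2)
      also have "\<dots> \<le> (p\<^sup>2 / \<delta> + \<delta> * (norm (h x))\<^sup>2) / 2"
      proof -
        have "2 * p * (\<delta> * norm (h x)) \<le> p\<^sup>2 + (\<delta> * norm (h x))\<^sup>2"
          by (rule sum_squares_bound)
        then have "(2 * p * (\<delta> * norm (h x))) / \<delta> \<le> (p\<^sup>2 + (\<delta> * norm (h x))\<^sup>2) / \<delta>"
          using \<delta> by (intro divide_right_mono) auto
        then show ?thesis
          using \<delta> by (simp add: power2_eq_square add_divide_distrib mult_ac)
      qed
      finally show ?thesis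
        using \<open>x \<in> C\<close> by (simp add: b_def p_def)
    qed
    have "(LINT x|lebesgue. w n x \<bullet> h x) - (LINT x|lebesgue. u x \<bullet> h x) = (LINT x|lebesgue. (w n x - u x) \<bullet> h x)"
      using int by (simp add: inner_diff_left)
    also have "\<bar>\<dots>\<bar> \<le> (LINT x|lebesgue. b x)"
      using Bochner_Integration.integral_norm_bound_integral[OF _ bi, of "\<lambda>x. (w n x - u x) \<bullet> h x"] int pt
      by (simp add: inner_diff_left)
    also have "\<dots> = (I n / \<delta> + \<delta> * H) / 2"
      using sq[of n] Hi
      by (simp add: b_def[abs_def] I_def H_def set_integrable_def set_lebesgue_integral_def)
    finally show ?thesis .
  qed
  have "\<forall>\<^sub>F n in sequentially. I n < e * \<delta>"
    using lim e \<delta> unfolding I_def by (intro order_tendstoD(2)[OF lim]) auto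
  then obtain K where K: "\<And>n. n \<ge> K \<Longrightarrow> I n < e * \<delta>"
    by (auto simp: eventually_sequentially)
  have "norm ((LINT x|lebesgue. w n x \<bullet> h x) - (LINT x|lebesgue. u x \<bullet> h x)) < e" if "n \<ge> K" for n
  proof -
    have "I n / \<delta> < e"
      using K[OF that] \<delta> by (simp add: field_simps)
    moreover have "\<delta> * H \<le> e"
      using e H by (simp add: \<delta>_def field_simps)
    ultimately show ?thesis
      using bound[of n] by simp
  qed
  then show "\<exists>K. \<forall>n\<ge>K. norm ((LINT x|lebesgue. w n x \<bullet> h x) - (LINT x|lebesgue. u x \<bullet> h x)) < e"
    by blast
qed

section \<open>Weak curls of fields in \<open>BLC\<close>\<close>

lemma has_derivative_imp_frechet: "(f has_derivative F) (at x) \<Longrightarrow> frechet_derivative f (at x) = F"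
  using frechet_derivative_at by metis

lemma curl_diff:
  assumes "f differentiable (at x)" "g differentiable (at x)"
  shows "curl (\<lambda>x. f x - g x) x = curl f x - curl g x"
proof -
  have "frechet_derivative (\<lambda>x. f x - g x) (at x)
      = (\<lambda>v. frechet_derivative f (at x) v - frechet_derivative g (at x) v)"
    using assms by (intro has_derivative_imp_frechet has_derivative_diff) (simp_all add: frechet_derivative_works)
  then show ?thesis
    by (simp add: curl_eq_sum_cross Cross3.right_diff_distrib sum_subtractf)
qed

lemma L2_locD:
  assumes "u \<in> L2_loc"
  shows "u \<in> borel_measurable lebesgue" "compact C \<Longrightarrow> set_integrable lebesgue C (\<lambda>x. (norm (u x))\<^sup>2)"
  using assms by (auto simp: L2_loc_def)

lemma continuous_L2_loc:
  assumes "continuous_on UNIV u"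
  shows "u \<in> L2_loc"
  unfolding L2_loc_def
proof (intro CollectI conjI allI impI)
  fix C :: "(real^3) set" assume "compact C"
  then have "integrable lborel (\<lambda>x. indicator C x *\<^sub>R (norm (u x))\<^sup>2)"
    by (intro borel_integrable_compact continuous_intros) (auto intro: continuous_on_subset[OF assms])
  then show "set_integrable lebesgue C (\<lambda>x. (norm (u x))\<^sup>2)"
    by (simp add: set_integrable_def integrable_completion)
qed (rule continuous_imp_borel_measurable_lebesgue[OF assms])

lemma L2_loc_diff:
  assumes "u \<in> L2_loc" "v \<in> L2_loc"
  shows "(\<lambda>x. u x - v x) \<in> L2_loc"
  unfolding L2_loc_def
proof (intro CollectI conjI allI impI)
  note m = L2_locD(1)[OF assms(1)] L2_locD(1)[OF assms(2)]
  show "(\<lambda>x. u x - v x) \<in> borel_measurable lebesgue"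
    using m by (rule borel_measurable_diff)
  fix C :: "(real^3) set" assume C: "compact C"
  then have Cm: "C \<in> sets lebesgue"
    using lmeasurable_compact fmeasurableD by blast
  have eq: "(norm (indicat_real C x *\<^sub>R y))\<^sup>2 = indicat_real C x *\<^sub>R (norm y)\<^sup>2" for x and y :: "real^3"
    by (simp add: indicator_def)
  have "integrable lebesgue (\<lambda>x. (norm (indicat_real C x *\<^sub>R w x))\<^sup>2)" if "w \<in> L2_loc" for w
    using L2_locD(2)[OF that C] by (simp only: eq set_integrable_def)
  then have "integrable lebesgue (\<lambda>x. (norm (indicat_real C x *\<^sub>R u x - indicat_real C x *\<^sub>R v x))\<^sup>2)"
    using m Cm assms
    by (intro integrable_norm_diff_square borel_measurable_scaleR borel_measurable_indicator)
  then show "set_integrable lebesgue C (\<lambda>x. (norm (u x - v x))\<^sup>2)"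
    by (simp only: eq set_integrable_def flip: scaleR_diff_right)
qed

lemma L2_loc_locally_integrable: "u \<in> L2_loc \<Longrightarrow> locally_integrable u"
  using L2_locD by (blast intro: locally_integrable_if_square_integrable)

text \<open>The curls of the approximating fields are Cauchy in L2, because \<open>curl_norm\<close>
  is the L2 norm of the curl. Their limit is the weak curl: integration by parts holds for each
  approximant and both sides converge.\<close>

lemma BLC_has_weak_curl:
  assumes "u \<in> BLC"
  obtains g where "has_weak_curl u g" "integrable lebesgue (\<lambda>x. (norm (g x))\<^sup>2)"
proof -
  obtain \<phi> c where u: "u \<in> L2_loc" and \<phi>: "\<And>n. \<phi> n \<in> solenoidal_tests"
    and Cauchy: "\<forall>e>0. \<exists>N. \<forall>m\<ge>N. \<forall>n\<ge>N. curl_norm (\<lambda>x. \<phi> m x - \<phi> n x) < e"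
    and conv: "tendsto_L2_loc (\<lambda>n x. \<phi> n x + c n) u"
    using assms by (auto simp: BLC_def)
  have test: "\<phi> n \<in> test_fields" for n
    using \<phi> by (simp add: solenoidal_tests_def)
  note C1 = test_fieldsD(1)[OF test, where k = 1] and supp = test_fieldsD(2)[OF test]
  define f where "f n = curl (\<phi> n)" for n
  have cf: "continuous_on UNIV (f n)" for n
    unfolding f_def by (rule continuous_on_curl[OF C1])
  have fi: "integrable lebesgue (\<lambda>x. (norm (f n x))\<^sup>2)" for n
    using bounded_subset[OF bounded_support_curl[OF supp], of "{x. (norm (f n x))\<^sup>2 \<noteq> 0}" n]
    by (intro integrable_continuous_bounded_support continuous_intros cf) (auto simp: f_def)
  have fC: "\<exists>N. \<forall>m\<ge>N. \<forall>n\<ge>N. (LINT x|lebesgue. (norm (f m x - f n x))\<^sup>2) < e" if "e > 0" for e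
  proof -
    have cn: "curl_norm (\<lambda>x. \<phi> m x - \<phi> n x) = sqrt (LINT x|lebesgue. (norm (f m x - f n x))\<^sup>2)" for m n
      using test_fields_differentiable[OF test] by (simp add: curl_norm_def f_def curl_diff)
    have "sqrt e > 0" using that by simp
    then show ?thesis
      using Cauchy[rule_format, of "sqrt e"] unfolding cn real_sqrt_less_iff by blast
  qed
  obtain g where g: "g \<in> borel_measurable lebesgue" "integrable lebesgue (\<lambda>x. (norm (g x))\<^sup>2)"
    and lim: "(\<lambda>n. LINT x|lebesgue. (norm (f n x - g x))\<^sup>2) \<longlonglongrightarrow> 0"
    using L2_complete[OF continuous_imp_borel_measurable_lebesgue[OF cf] fi fC] by blast
  have sets: "C \<in> sets lebesgue" if "compact C" for C :: "(real^3) set"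
    using that lmeasurable_compact fmeasurableD by blast
  have gsq: "set_integrable lebesgue C (\<lambda>x. (norm (g x))\<^sup>2)" if "compact C" for C
    using integrable_mult_indicator[OF sets[OF that] g(2)] by (simp add: set_integrable_def)
  then have gl: "g \<in> L2_loc"
    using g(1) by (simp add: L2_loc_def)
  have "has_weak_curl u g"
    unfolding has_weak_curl_def
  proof (intro conjI ballI)
    show lu: "locally_integrable u" and lg: "locally_integrable g"
      using u gl by (auto intro: L2_loc_locally_integrable)
    fix \<psi> assume \<psi>: "\<psi> \<in> test_fields"
    note \<psi>C = test_fieldsD(1)[OF \<psi>, where k = 1] and \<psi>s = test_fieldsD(2)[OF \<psi>]
    have c\<psi>: "continuous_on UNIV \<psi>"
      using test_fieldsD(1)[OF \<psi>, of 0] by simp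
    note cc = continuous_on_curl[OF \<psi>C] and cs = bounded_support_curl[OF \<psi>s]
    have Cn: "Ck 1 (\<lambda>x. \<phi> n x + c n)" for n
      by (rule Ck_add[OF C1 Ck_const])
    then have cn: "continuous_on UNIV (\<lambda>x. \<phi> n x + c n)" for n
      using Ck_SucD[of 0 "\<lambda>x. \<phi> n x + c n"] by simp
    \<comment> \<open>The constants \<open>c n\<close> may diverge, but they have no curl. Nor does
      the lack of compact support that they cause matter, since the test field has it.\<close>
    have cadd: "curl (\<lambda>x. \<phi> n x + c n) x = f n x" for n x
    proof -
      have "curl (\<lambda>x. \<phi> n x - (- c n)) x = f n x"
        using test_fields_differentiable[OF test]
        by (subst curl_diff) (auto simp: f_def curl_eq_sum_cross[of "\<lambda>_. _"])
      then show ?thesis by simp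
    qed
    have "(\<lambda>n. LINT x|lebesgue. (\<phi> n x + c n) \<bullet> curl \<psi> x) \<longlonglongrightarrow> (LINT x|lebesgue. u x \<bullet> curl \<psi> x)"
    proof (rule tendsto_integral_inner_L2[where C = "closure {x. curl \<psi> x \<noteq> 0}"])
      have K: "compact (closure {x. curl \<psi> x \<noteq> 0})"
        using cs by simp
      show "set_integrable lebesgue (closure {x. curl \<psi> x \<noteq> 0}) (\<lambda>x. (norm (\<phi> n x + c n - u x))\<^sup>2)" for n
        using L2_locD(2)[OF L2_loc_diff[OF continuous_L2_loc[OF cn] u] K] .
      show "(\<lambda>n. LINT x:closure {x. curl \<psi> x \<noteq> 0}|lebesgue. (norm (\<phi> n x + c n - u x))\<^sup>2) \<longlonglongrightarrow> 0"
        using conv K by (simp add: tendsto_L2_loc_def)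
      show "integrable lebesgue (\<lambda>x. (\<phi> n x + c n) \<bullet> curl \<psi> x)" for n
        by (rule locally_integrable_inner[OF L2_loc_locally_integrable[OF continuous_L2_loc[OF cn]] cc cs])
      show "integrable lebesgue (\<lambda>x. u x \<bullet> curl \<psi> x)"
        by (rule locally_integrable_inner[OF lu cc cs])
    qed (use cc cs closure_subset[of "{x. curl \<psi> x \<noteq> 0}"] in auto)
    moreover have "(LINT x|lebesgue. (\<phi> n x + c n) \<bullet> curl \<psi> x) = (LINT x|lebesgue. f n x \<bullet> \<psi> x)" for n
      using integral_by_parts_curl[OF Cn \<psi>C \<psi>s] by (simp add: cadd)
    moreover have "(\<lambda>n. LINT x|lebesgue. f n x \<bullet> \<psi> x) \<longlonglongrightarrow> (LINT x|lebesgue. g x \<bullet> \<psi> x)"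
    proof (rule tendsto_integral_inner_L2[where C = UNIV])
      show "set_integrable lebesgue UNIV (\<lambda>x. (norm (f n x - g x))\<^sup>2)" for n
        using integrable_norm_diff_square[OF continuous_imp_borel_measurable_lebesgue[OF cf] g(1) fi g(2)]
        by (simp add: set_integrable_def)
      show "(\<lambda>n. LINT x:UNIV|lebesgue. (norm (f n x - g x))\<^sup>2) \<longlonglongrightarrow> 0"
        using lim by (simp add: set_lebesgue_integral_def)
      show "integrable lebesgue (\<lambda>x. f n x \<bullet> \<psi> x)" for n
        by (rule locally_integrable_inner[OF L2_loc_locally_integrable[OF continuous_L2_loc[OF cf]] c\<psi> \<psi>s])
      show "integrable lebesgue (\<lambda>x. g x \<bullet> \<psi> x)"
        by (rule locally_integrable_inner[OF lg c\<psi> \<psi>s])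
    qed (use c\<psi> \<psi>s in auto)
    ultimately show "(LINT x|lebesgue. u x \<bullet> curl \<psi> x) = (LINT x|lebesgue. g x \<bullet> \<psi> x)"
      using LIMSEQ_unique by fastforce
  qed
  then show ?thesis
    using that g(2) by blast
qed

section \<open>The action of rotations on the Beppo Levi space\<close>

lemma compact_imp_lebesgue_sets: "compact C \<Longrightarrow> C \<in> sets lebesgue"
  using lmeasurable_compact fmeasurableD by blast

lemma compact_rotated:
  fixes R :: "real^3^3"
  shows "compact C \<Longrightarrow> compact ((*v) R ` C)"
  by (intro compact_continuous_image linear_continuous_on) auto

lemma orthogonal_matrix_mem_image:
  fixes R :: "real^3^3"
  assumes "orthogonal_matrix R"
  shows "R *v x \<in> (*v) R ` C \<longleftrightarrow> x \<in> C"
  using orthogonal_matrix_cancel(1)[OF assms] by (metis (no_types, lifting) image_iff)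

lemma set_integral_rotated:
  fixes R :: "real^3^3" and f :: "real^3 \<Rightarrow> 'b::euclidean_space"
  assumes R: "orthogonal_matrix R" and C: "compact C"
  shows "f \<in> borel_measurable lebesgue \<Longrightarrow> (LINT x:C|lebesgue. f (R *v x)) = (LINT x:(*v) R ` C|lebesgue. f x)"
    and "set_integrable lebesgue ((*v) R ` C) f \<Longrightarrow> set_integrable lebesgue C (\<lambda>x. f (R *v x))"
proof -
  define F where "F y = indicat_real ((*v) R ` C) y *\<^sub>R f y" for y
  have F: "indicat_real C x *\<^sub>R f (R *v x) = F (R *v x)" for x
    by (simp add: F_def indicator_def orthogonal_matrix_mem_image[OF R])
  show "set_integrable lebesgue C (\<lambda>x. f (R *v x))" if "set_integrable lebesgue ((*v) R ` C) f"
    using integrable_rotated[OF R, of F] that by (simp add: set_integrable_def F F_def[abs_def])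
  show "(LINT x:C|lebesgue. f (R *v x)) = (LINT x:(*v) R ` C|lebesgue. f x)" if "f \<in> borel_measurable lebesgue"
  proof -
    have "F \<in> borel_measurable lebesgue"
      unfolding F_def[abs_def] using that compact_imp_lebesgue_sets[OF compact_rotated[OF C]]
      by (intro borel_measurable_scaleR borel_measurable_indicator)
    from integral_rotated[OF R this] show ?thesis
      by (simp add: set_lebesgue_integral_def F F_def[abs_def])
  qed
qed

lemma pullback_norm: "orthogonal_matrix R \<Longrightarrow> norm (pullback R f x) = norm (f (R *v x))"
  using orthogonal_matrix_inner(3)[of "transpose R" "f (R *v x)"] by (simp add: pullback_def)

lemma pseudo_pullback_norm: "orthogonal_matrix R \<Longrightarrow> norm (pseudo_pullback R f x) = norm (f (R *v x))"
  using det_orthogonal_matrix[of R] by (auto simp: pseudo_pullback_def pullback_norm)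

lemma borel_measurable_pullback:
  assumes "orthogonal_matrix R" "f \<in> borel_measurable lebesgue"
  shows "pullback R f \<in> borel_measurable lebesgue" "pseudo_pullback R f \<in> borel_measurable lebesgue"
proof -
  have "(*v) (transpose R) \<in> borel_measurable borel"
    by (intro borel_measurable_continuous_onI linear_continuous_on) simp
  from measurable_compose[OF borel_measurable_rotated[OF assms] this]
  show p: "pullback R f \<in> borel_measurable lebesgue"
    by (simp add: pullback_def[abs_def])
  show "pseudo_pullback R f \<in> borel_measurable lebesgue"
    unfolding pseudo_pullback_def[abs_def] by (intro borel_measurable_scaleR p borel_measurable_const)
qed

lemma pullback_inner:
  assumes "orthogonal_matrix R"
  shows "pullback R f x \<bullet> pullback R g x = f (R *v x) \<bullet> g (R *v x)"
  using assms by (simp add: pullback_def orthogonal_matrix_inner(2) orthogonal_matrix_cancel)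

lemma locally_integrable_pullback:
  assumes R: "orthogonal_matrix R" and u: "locally_integrable u"
  shows "locally_integrable (pullback R u)" "locally_integrable (pseudo_pullback R u)"
proof -
  have p: "set_integrable lebesgue C (pullback R u)" if C: "compact C" for C
  proof -
    have "set_integrable lebesgue C (\<lambda>x. u (R *v x))"
      using u compact_rotated[OF C] by (intro set_integral_rotated(2)[OF R C]) (auto simp: locally_integrable_def)
    then have "integrable lebesgue (\<lambda>x. transpose R *v (indicat_real C x *\<^sub>R u (R *v x)))"
      unfolding set_integrable_def by (intro integrable_bounded_linear[OF matrix_vector_mul_bounded_linear])
    then show ?thesis
      by (simp add: set_integrable_def pullback_def matrix_vector_mult_scaleR)
  qed
  then show "locally_integrable (pullback R u)"
    using u borel_measurable_pullback[OF R] by (simp add: locally_integrable_def)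
  have "set_integrable lebesgue C (pseudo_pullback R u)" if "compact C" for C
    unfolding pseudo_pullback_def[abs_def] using p[OF that] by (intro set_integrable_scaleR_right) 
  then show "locally_integrable (pseudo_pullback R u)"
    using u borel_measurable_pullback[OF R] by (simp add: locally_integrable_def)
qed

lemma pseudo_pullback_diff:
  "pseudo_pullback R (\<lambda>x. f x - g x) x = pseudo_pullback R f x - pseudo_pullback R g x"
  by (simp add: pseudo_pullback_def pullback_def matrix_vector_mult_diff_distrib scaleR_diff_right)

lemma pseudo_pullback_add_const:
  "pseudo_pullback R (\<lambda>x. f x + c) x = pseudo_pullback R f x + det R *\<^sub>R (transpose R *v c)"
  by (simp add: pseudo_pullback_def pullback_def matrix_vector_right_distrib scaleR_add_right)

lemma test_fields_diff:
  assumes "f \<in> test_fields" "g \<in> test_fields"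
  shows "(\<lambda>x. f x - g x) \<in> test_fields"
proof (rule test_fieldsI)
  fix k
  have "Ck k (\<lambda>x. f x + - g x)"
    using test_fieldsD(1)[OF assms(1)] test_fieldsD(1)[OF assms(2)]
    by (intro Ck_add Ck_linear_compose[OF bounded_linear_minus[OF bounded_linear_ident]])
  then show "Ck k (\<lambda>x. f x - g x)"
    by simp
next
  have "bounded ({x. f x \<noteq> 0} \<union> {x. g x \<noteq> 0})"
    using test_fieldsD(2)[OF assms(1)] test_fieldsD(2)[OF assms(2)] by simp
  then show "bounded {x. f x - g x \<noteq> 0}"
    by (rule bounded_subset) auto
qed

lemma curl_norm_pseudo_pullback:
  assumes R: "orthogonal_matrix R" and f: "f \<in> test_fields"
  shows "curl_norm (pseudo_pullback R f) = curl_norm f"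
proof -
  have "curl f \<in> borel_measurable lebesgue"
    by (intro continuous_imp_borel_measurable_lebesgue continuous_on_curl test_fieldsD(1)[OF f])
  then have "(\<lambda>x. (norm (curl f x))\<^sup>2) \<in> borel_measurable lebesgue"
    by measurable
  from integral_rotated[OF R this] show ?thesis
    by (simp add: curl_norm_def curl_pseudo_pullback[OF R test_fields_differentiable[OF f]] pullback_norm[OF R])
qed

text \<open>The approximating fields and constants are rotated along with \<open>u\<close>. The
  action is linear and preserves \<open>curl_norm\<close>, hence the Cauchy property; local
  convergence on \<open>C\<close> becomes convergence on the compact set \<open>R C\<close>.\<close>

lemma BLC_pseudo_pullback:
  assumes R: "orthogonal_matrix R" and "u \<in> BLC"
  shows "pseudo_pullback R u \<in> BLC"
proof -
  obtain \<phi> c where u: "u \<in> L2_loc" and \<phi>: "\<And>n. \<phi> n \<in> solenoidal_tests"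
    and Cauchy: "\<forall>e>0. \<exists>N. \<forall>m\<ge>N. \<forall>n\<ge>N. curl_norm (\<lambda>x. \<phi> m x - \<phi> n x) < e"
    and conv: "tendsto_L2_loc (\<lambda>n x. \<phi> n x + c n) u"
    using assms by (auto simp: BLC_def)
  have test: "\<phi> n \<in> test_fields" for n
    using \<phi> by (simp add: solenoidal_tests_def)
  define \<phi>' c' where "\<phi>' n = pseudo_pullback R (\<phi> n)" and "c' n = det R *\<^sub>R (transpose R *v c n)" for n
  have um: "u \<in> borel_measurable lebesgue"
    using L2_locD(1)[OF u] .
  have "pseudo_pullback R u \<in> L2_loc"
    unfolding L2_loc_def
  proof (intro CollectI conjI allI impI borel_measurable_pullback(2)[OF R um])
    fix C :: "(real^3) set" assume C: "compact C"
    show "set_integrable lebesgue C (\<lambda>x. (norm (pseudo_pullback R u x))\<^sup>2)"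
      unfolding pseudo_pullback_norm[OF R]
      by (rule set_integral_rotated(2)[OF R C L2_locD(2)[OF u compact_rotated[OF C]]])
  qed
  moreover have "\<phi>' n \<in> solenoidal_tests" for n
    unfolding \<phi>'_def by (rule solenoidal_tests_pseudo_pullback[OF R \<phi>])
  moreover have "curl_norm (\<lambda>x. \<phi>' m x - \<phi>' n x) = curl_norm (\<lambda>x. \<phi> m x - \<phi> n x)" for m n
    using curl_norm_pseudo_pullback[OF R test_fields_diff[OF test test]]
    by (simp add: \<phi>'_def flip: pseudo_pullback_diff)
  moreover have "tendsto_L2_loc (\<lambda>n x. \<phi>' n x + c' n) (pseudo_pullback R u)"
    unfolding tendsto_L2_loc_def
  proof (intro allI impI)
    fix C :: "(real^3) set" assume C: "compact C"
    have "(LINT x:C|lebesgue. (norm (\<phi>' n x + c' n - pseudo_pullback R u x))\<^sup>2)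
        = (LINT x:(*v) R ` C|lebesgue. (norm (\<phi> n x + c n - u x))\<^sup>2)" for n
    proof -
      have "\<phi> n \<in> borel_measurable lebesgue"
        using test_fieldsD(1)[OF test, of 0 n] by (simp add: continuous_imp_borel_measurable_lebesgue)
      then have "(\<lambda>x. (norm (\<phi> n x + c n - u x))\<^sup>2) \<in> borel_measurable lebesgue"
        using um by (intro borel_measurable_power borel_measurable_norm borel_measurable_diff borel_measurable_add) auto
      moreover have "norm (\<phi>' n x + c' n - pseudo_pullback R u x) = norm (\<phi> n (R *v x) + c n - u (R *v x))" for x
        using pseudo_pullback_norm[OF R, of "\<lambda>x. \<phi> n x + c n - u x" x]
        by (simp add: pseudo_pullback_diff pseudo_pullback_add_const \<phi>'_def c'_def)
      ultimately show ?thesis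
        using set_integral_rotated(1)[OF R C] by simp
    qed
    then show "(\<lambda>n. LINT x:C|lebesgue. (norm (\<phi>' n x + c' n - pseudo_pullback R u x))\<^sup>2) \<longlonglongrightarrow> 0"
      using conv compact_rotated[OF C] by (simp add: tendsto_L2_loc_def)
  qed
  ultimately show ?thesis
    using Cauchy unfolding BLC_def by (intro CollectI conjI exI[of _ \<phi>'] exI[of _ c'] bexI) auto
qed

text \<open>Every test field is the rotation of another one, \<eta>. After this substitution
  \<open>det R\<close> occurs once on each side, from the potential on the left and from the test
  field on the right.\<close>

lemma has_weak_curl_pseudo_pullback:
  assumes R: "orthogonal_matrix R" and u: "has_weak_curl u g"
  shows "has_weak_curl (pseudo_pullback R u) (pullback R g)"
  unfolding has_weak_curl_def
proof (intro conjI ballI)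
  have lu: "locally_integrable u" and lg: "locally_integrable g"
    using u by (auto simp: has_weak_curl_def)
  show "locally_integrable (pseudo_pullback R u)" "locally_integrable (pullback R g)"
    using lu lg by (auto intro: locally_integrable_pullback[OF R])
  fix \<psi> assume \<psi>: "\<psi> \<in> test_fields"
  define \<eta> where "\<eta> = pseudo_pullback (transpose R) \<psi>"
  have \<eta>: "\<eta> \<in> test_fields"
    using test_fields_pseudo_pullback[OF _ \<psi>, of "transpose R"] R by (simp add: \<eta>_def)
  have \<psi>\<eta>: "\<psi> = pseudo_pullback R \<eta>"
    by (simp add: \<eta>_def pseudo_pullback_transpose[OF R])
  have "\<eta> \<in> borel_measurable lebesgue" "curl \<eta> \<in> borel_measurable lebesgue"
    using test_fieldsD(1)[OF \<eta>, of 0] continuous_on_curl[OF test_fieldsD(1)[OF \<eta>]]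
    by (auto intro: continuous_imp_borel_measurable_lebesgue)
  then have m: "(\<lambda>x. u x \<bullet> curl \<eta> x) \<in> borel_measurable lebesgue" "(\<lambda>x. g x \<bullet> \<eta> x) \<in> borel_measurable lebesgue"
    using lu lg by (auto simp: locally_integrable_def intro: borel_measurable_inner)
  have "(LINT x|lebesgue. pseudo_pullback R u x \<bullet> curl \<psi> x) = (LINT x|lebesgue. det R * (u (R *v x) \<bullet> curl \<eta> (R *v x)))"
    by (simp add: \<psi>\<eta> curl_pseudo_pullback[OF R test_fields_differentiable[OF \<eta>]] pseudo_pullback_def[of R u]
        pullback_inner[OF R])
  also have "\<dots> = det R * (LINT x|lebesgue. u x \<bullet> curl \<eta> x)"
    using integral_rotated[OF R m(1)] by simp
  also have "\<dots> = det R * (LINT x|lebesgue. g x \<bullet> \<eta> x)"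
    using u \<eta> by (simp add: has_weak_curl_def)
  also have "\<dots> = (LINT x|lebesgue. det R * (g (R *v x) \<bullet> \<eta> (R *v x)))"
    using integral_rotated[OF R m(2)] by simp
  also have "\<dots> = (LINT x|lebesgue. pullback R g x \<bullet> \<psi> x)"
    by (simp add: \<psi>\<eta> pseudo_pullback_def[of R \<eta>] pullback_inner[OF R])
  finally show "(LINT x|lebesgue. pseudo_pullback R u x \<bullet> curl \<psi> x) = (LINT x|lebesgue. pullback R g x \<bullet> \<psi> x)" .
qed

section \<open>Classes modulo constants and their curls\<close>

lemma curl_const: "curl (\<lambda>_. c) x = 0"
  by (simp add: curl_eq_sum_cross)

text \<open>A constant integrates to 0 against any curl of a test field, again by parts. Hence all
  members of a class share their weak curls.\<close>

lemma has_weak_curl_shift: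
  assumes v: "has_weak_curl v g" and u: "locally_integrable u"
    and eq: "AE x in lebesgue. u x = v x + c"
  shows "has_weak_curl u g"
  unfolding has_weak_curl_def
proof (intro conjI ballI)
  show "locally_integrable u" "locally_integrable g"
    using v u by (auto simp: has_weak_curl_def)
  fix \<psi> assume \<psi>: "\<psi> \<in> test_fields"
  note C1 = test_fieldsD(1)[OF \<psi>, where k = 1] and supp = test_fieldsD(2)[OF \<psi>]
  note cc = continuous_on_curl[OF C1] and cs = bounded_support_curl[OF supp]
  have iv: "integrable lebesgue (\<lambda>x. v x \<bullet> curl \<psi> x)"
    using v by (intro locally_integrable_inner cc cs) (simp add: has_weak_curl_def)
  have ic: "integrable lebesgue (\<lambda>x. c \<bullet> curl \<psi> x)"
    by (intro integrable_inner_right integrable_continuous_bounded_support cc cs)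
  have m: "(\<lambda>x. u x \<bullet> curl \<psi> x) \<in> borel_measurable lebesgue"
    using locally_integrable_inner[OF u cc cs] by (rule borel_measurable_integrable)
  have "(LINT x|lebesgue. u x \<bullet> curl \<psi> x) = (LINT x|lebesgue. v x \<bullet> curl \<psi> x + c \<bullet> curl \<psi> x)"
    using eq m iv ic by (intro integral_cong_AE) (auto simp: inner_add_left)
  also have "\<dots> = (LINT x|lebesgue. v x \<bullet> curl \<psi> x) + (LINT x|lebesgue. c \<bullet> curl \<psi> x)"
    using iv ic by simp
  also have "(LINT x|lebesgue. c \<bullet> curl \<psi> x) = 0"
    using integral_by_parts_curl[OF Ck_const C1 supp, of c] by (simp add: curl_const)
  finally show "(LINT x|lebesgue. u x \<bullet> curl \<psi> x) = (LINT x|lebesgue. g x \<bullet> \<psi> x)"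
    using v \<psi> by (simp add: has_weak_curl_def)
qed

lemma BLC_weak_curl:
  assumes "u \<in> BLC"
  shows "has_weak_curl u (weak_curl u)"
    and "weak_curl u \<in> borel_measurable lebesgue"
    and "integrable lebesgue (\<lambda>x. (norm (weak_curl u x))\<^sup>2)"
proof -
  obtain g where g: "has_weak_curl u g" "integrable lebesgue (\<lambda>x. (norm (g x))\<^sup>2)"
    using BLC_has_weak_curl[OF assms] by blast
  show w: "has_weak_curl u (weak_curl u)"
    unfolding weak_curl_def by (rule someI[of "has_weak_curl u", OF g(1)])
  then show m: "weak_curl u \<in> borel_measurable lebesgue"
    by (simp add: has_weak_curl_def locally_integrable_def)
  have "(\<lambda>x. (norm (weak_curl u x))\<^sup>2) \<in> borel_measurable lebesgue"
    using m by measurable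
  moreover have "AE x in lebesgue. (norm (g x))\<^sup>2 = (norm (weak_curl u x))\<^sup>2"
    using has_weak_curl_unique[OF g(1) w] by eventually_elim simp
  ultimately show "integrable lebesgue (\<lambda>x. (norm (weak_curl u x))\<^sup>2)"
    using g(2) integrable_cong_AE_imp by blast
qed

lemma BLC_locally_integrable: "u \<in> BLC \<Longrightarrow> locally_integrable u"
  using BLC_weak_curl(1) by (auto simp: has_weak_curl_def)

lemma BLC_dot_some:
  assumes "k \<in> BLC_dot"
  shows "(SOME u. u \<in> k) \<in> k" "k \<subseteq> BLC"
proof -
  obtain u where "u \<in> BLC" "k = BLC_rel `` {u}"
    using assms by (auto simp: BLC_dot_def elim: quotientE)
  moreover from this have "u \<in> k"
    by (auto simp: BLC_rel_def intro!: exI[of _ 0])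
  ultimately show "k \<subseteq> BLC"
    by (auto simp: BLC_rel_def)
  show "(SOME u. u \<in> k) \<in> k"
    using \<open>u \<in> k\<close> by (rule someI[of "\<lambda>u. u \<in> k"])
qed

lemma class_curl_measurable:
  assumes "k \<in> BLC_dot"
  shows "class_curl k \<in> borel_measurable lebesgue"
    and "integrable lebesgue (\<lambda>x. (norm (class_curl k x))\<^sup>2)"
    and "locally_integrable (class_curl k)"
  using BLC_dot_some[OF assms] BLC_weak_curl[of "SOME u. u \<in> k"]
  by (auto simp: class_curl_def has_weak_curl_def)

text \<open>Frees \<open>class_curl\<close> from both of its choices: it may be computed from any
  member of the class and any weak curl of that member.\<close>

lemma class_curl_AE:
  assumes k: "k \<in> BLC_dot" and u: "u \<in> k" "has_weak_curl u g"
  shows "AE x in lebesgue. class_curl k x = g x"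
proof -
  define v where "v = (SOME u. u \<in> k)"
  have v: "v \<in> k" "v \<in> BLC"
    using BLC_dot_some[OF k] by (auto simp: v_def)
  obtain u0 where "k = BLC_rel `` {u0}"
    using k by (auto simp: BLC_dot_def elim: quotientE)
  then obtain b c where b: "AE x in lebesgue. u0 x = u x + b" and c: "AE x in lebesgue. u0 x = v x + c"
    using u v by (auto simp: BLC_rel_def)
  have "AE x in lebesgue. v x = u x + (b - c)"
    using b c by eventually_elim (simp add: algebra_simps)
  then have "has_weak_curl v g"
    by (rule has_weak_curl_shift[OF u(2) BLC_locally_integrable[OF v(2)]])
  from has_weak_curl_unique[OF BLC_weak_curl(1)[OF v(2)] this]
  show ?thesis
    by (simp add: class_curl_def v_def)
qed

lemma BLC_rel_pseudo_pullback:
  assumes R: "orthogonal_matrix R" and "(u, v) \<in> BLC_rel"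
  shows "(pseudo_pullback R u, pseudo_pullback R v) \<in> BLC_rel"
proof -
  have uv: "u \<in> BLC" "v \<in> BLC" and "\<exists>c. AE x in lebesgue. u x = v x + c"
    using assms(2) by (simp_all add: BLC_rel_def)
  then obtain c where c: "AE x in lebesgue. u x = v x + c"
    by blast
  from AE_rotated[OF R c]
  have "AE x in lebesgue. pseudo_pullback R u x = pseudo_pullback R v x + det R *\<^sub>R (transpose R *v c)"
    by eventually_elim
      (simp add: pseudo_pullback_def pullback_def matrix_vector_right_distrib scaleR_add_right)
  then show ?thesis
    using uv BLC_pseudo_pullback[OF R] by (auto simp: BLC_rel_def)
qed

text \<open>The image of a class is the full class of the rotated field, not merely a part of it,
  because the transpose acts as the inverse.\<close>

lemma BLC_rel_image_pseudo_pullback: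
  assumes R: "orthogonal_matrix R"
  shows "pseudo_pullback R ` (BLC_rel `` {u}) = BLC_rel `` {pseudo_pullback R u}"
proof (intro set_eqI iffI)
  fix w assume "w \<in> BLC_rel `` {pseudo_pullback R u}"
  then have "(pseudo_pullback (transpose R) (pseudo_pullback R u), pseudo_pullback (transpose R) w) \<in> BLC_rel"
    using R by (intro BLC_rel_pseudo_pullback) auto
  then have "pseudo_pullback (transpose R) w \<in> BLC_rel `` {u}"
    using pseudo_pullback_transpose[of "transpose R" u] R by simp
  then show "w \<in> pseudo_pullback R ` (BLC_rel `` {u})"
    by (intro image_eqI[of _ _ "pseudo_pullback (transpose R) w"]) (simp_all add: pseudo_pullback_transpose[OF R])
qed (auto intro: BLC_rel_pseudo_pullback[OF R])

lemma BLC_dot_pseudo_pullback: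
  assumes R: "orthogonal_matrix R" and "k \<in> BLC_dot"
  shows "pseudo_pullback R ` k \<in> BLC_dot"
proof -
  obtain u where "u \<in> BLC" "k = BLC_rel `` {u}"
    using assms by (auto simp: BLC_dot_def elim: quotientE)
  then show ?thesis
    using BLC_pseudo_pullback[OF R] by (simp add: BLC_rel_image_pseudo_pullback[OF R] BLC_dot_def quotientI)
qed

lemma class_curl_pseudo_pullback:
  assumes R: "orthogonal_matrix R" and k: "k \<in> BLC_dot"
  shows "AE x in lebesgue. class_curl (pseudo_pullback R ` k) x = pullback R (class_curl k) x"
proof -
  define v where "v = (SOME u. u \<in> k)"
  have v: "v \<in> k" "v \<in> BLC"
    using BLC_dot_some[OF k] by (auto simp: v_def)
  have "has_weak_curl (pseudo_pullback R v) (pullback R (weak_curl v))"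
    by (rule has_weak_curl_pseudo_pullback[OF R BLC_weak_curl(1)[OF v(2)]])
  from class_curl_AE[OF BLC_dot_pseudo_pullback[OF R k] imageI[OF v(1)] this]
  show ?thesis
    by (simp add: class_curl_def v_def)
qed

lemma zero_in_BLC: "(\<lambda>x. 0) \<in> BLC"
proof -
  have "(\<lambda>x. 0) \<in> solenoidal_tests"
    by (auto simp: solenoidal_tests_def div3_def pd_def intro!: test_fieldsI Ck_const)
  moreover have "curl_norm (\<lambda>x. 0) = 0"
    by (simp add: curl_norm_def curl_const)
  ultimately show ?thesis
    unfolding BLC_def using continuous_L2_loc[of "\<lambda>x. 0"]
    by (auto simp: tendsto_L2_loc_def intro!: exI[of _ "\<lambda>n x. 0"] exI[of _ "\<lambda>n. 0"])
qed

text \<open>Holds for the fallback value too, so measurability and square integrability of the curl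
  are available whether or not the exterior problem is well posed.\<close>

lemma K_in_BLC_dot: "K a1 a2 \<omega> W \<in> BLC_dot"
proof (cases "\<exists>!k. solves_K a1 a2 \<omega> W k")
  case True
  from theI'[OF this] have "(THE k. solves_K a1 a2 \<omega> W k) \<in> BLC_dot"
    unfolding solves_K_def by (rule conjunct1)
  then show ?thesis
    using True by (simp add: K_def)
next
  case False
  then show ?thesis
    using zero_in_BLC by (auto simp: K_def BLC_dot_def intro: quotientI)
qed

section \<open>Equivariance of the exterior problem\<close>

text \<open>On the ball of radius |h| around \<open>U\<close> the derivative deviates from its value
  at \<open>U\<close> by at most c |h|; the mean value inequality contributes the second factor
  |h|.\<close>

lemma linearization_error:
  fixes a :: "'a::real_normed_vector \<Rightarrow> 'b::real_normed_vector"
  assumes diff: "\<And>x. a differentiable (at x)" and c: "c \<ge> 0"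
    and lip: "\<And>x y. onorm (\<lambda>h. frechet_derivative a (at x) h - frechet_derivative a (at y) h) \<le> c * norm (x - y)"
  shows "norm (a (h + U) - a U - frechet_derivative a (at U) h) \<le> c * (norm h)\<^sup>2"
proof -
  have "norm (a (h + U) - a U - frechet_derivative a (at U) (h + U - U)) \<le> norm (h + U - U) * (c * norm h)"
  proof (rule differentiable_bound_linearization[where S = "cball U (norm h)"])
    show "(a has_derivative frechet_derivative a (at x)) (at x within cball U (norm h))" for x
      using diff[of x] by (simp add: frechet_derivative_works has_derivative_at_withinI)
    show "onorm (frechet_derivative a (at x) - frechet_derivative a (at U)) \<le> c * norm h"
      if "x \<in> cball U (norm h)" for x
    proof -
      have "onorm (frechet_derivative a (at x) - frechet_derivative a (at U)) \<le> c * norm (x - U)"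
        using lip[of x U] by (simp add: fun_diff_def)
      also have "\<dots> \<le> c * norm h"
        using that c by (intro mult_left_mono) (auto simp: dist_norm norm_minus_commute)
      finally show ?thesis .
    qed
    show "U + t *\<^sub>R (h + U - U) \<in> cball U (norm h)" if "t \<in> {0..1}" for t
      using that by (auto simp: dist_norm mult_left_le_one_le)
  qed auto
  then show ?thesis
    by (simp add: power2_eq_square mult_ac)
qed

lemma frechet_derivative_A_om:
  assumes "a1 differentiable (at U)" "a2 differentiable (at U)"
  shows "frechet_derivative (A_om a1 a2 \<omega> x) (at U) h
    = indicat_real \<omega> x *\<^sub>R frechet_derivative a1 (at U) h
      + indicat_real (- \<omega>) x *\<^sub>R frechet_derivative a2 (at U) h"
proof -
  have "(A_om a1 a2 \<omega> x has_derivative (\<lambda>h. indicat_real \<omega> x *\<^sub>R frechet_derivative a1 (at U) h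
      + indicat_real (- \<omega>) x *\<^sub>R frechet_derivative a2 (at U) h)) (at U)"
    unfolding A_om_def[abs_def] using assms
    by (intro has_derivative_add has_derivative_scaleR_right) (simp_all add: frechet_derivative_works)
  then show ?thesis
    by (simp add: has_derivative_imp_frechet)
qed

lemma borel_measurable_A_om:
  assumes a: "continuous_on UNIV a1" "continuous_on UNIV a2"
    and w: "\<omega> \<in> sets lebesgue" and g: "g \<in> borel_measurable lebesgue"
  shows "(\<lambda>x. A_om a1 a2 \<omega> x (g x)) \<in> borel_measurable lebesgue"
proof -
  have "(\<lambda>x. a1 (g x)) \<in> borel_measurable lebesgue" "(\<lambda>x. a2 (g x)) \<in> borel_measurable lebesgue"
    using a by (auto intro!: measurable_compose[OF g] borel_measurable_continuous_onI)
  moreover have "- \<omega> \<in> sets lebesgue"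
    using sets.compl_sets[OF w] by (simp add: Compl_eq_Diff_UNIV)
  ultimately show ?thesis
    unfolding A_om_def using w
    by (intro borel_measurable_add borel_measurable_scaleR borel_measurable_indicator)
qed

text \<open>The identity a(Ry) = R a(y) is differentiated on both sides; derivatives are
  unique.\<close>

lemma frechet_derivative_equivariant:
  fixes R :: "real^3^3"
  assumes diff: "\<And>x. a differentiable (at x)" and eq: "\<And>y. a (R *v y) = R *v a y"
  shows "frechet_derivative a (at (R *v U)) (R *v h) = R *v frechet_derivative a (at U) h"
proof -
  have d: "(a has_derivative frechet_derivative a (at x)) (at x)" for x
    using diff by (simp add: frechet_derivative_works)
  have R: "bounded_linear ((*v) R)" by simp
  have "((\<lambda>y. a (R *v y)) has_derivative (\<lambda>h. frechet_derivative a (at (R *v U)) (R *v h))) (at U)"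
    by (rule has_derivative_compose[OF bounded_linear_imp_has_derivative[OF R] d])
  moreover have "((\<lambda>y. a (R *v y)) has_derivative (\<lambda>h. R *v frechet_derivative a (at U) h)) (at U)"
    unfolding eq by (rule bounded_linear.has_derivative[OF R d])
  ultimately show ?thesis
    by (metis has_derivative_unique)
qed

text \<open>What the symmetry argument draws on. The region enters through measurability and its
  invariance under orthogonal maps.\<close>

locale isotropic_pair =
  fixes a1 a2 :: "real^3 \<Rightarrow> real^3" and \<omega> :: "(real^3) set"
  assumes C1: "Ck 1 a1" "Ck 1 a2"
    and equivariant: "orthogonal_matrix R \<Longrightarrow> a1 (R *v y) = R *v a1 y"
      "orthogonal_matrix R \<Longrightarrow> a2 (R *v y) = R *v a2 y"
    and omega_measurable: "\<omega> \<in> sets lebesgue"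
    and omega_invariant: "orthogonal_matrix R \<Longrightarrow> R *v x \<in> \<omega> \<longleftrightarrow> x \<in> \<omega>"
begin

lemma differentiable: "a1 differentiable (at x)" "a2 differentiable (at x)"
  using C1 by simp_all

lemma continuous: "continuous_on UNIV a1" "continuous_on UNIV a2"
  using C1 Ck_SucD[of 0] by auto

lemma equivariant_transpose:
  assumes "orthogonal_matrix R"
  shows "a1 (transpose R *v y) = transpose R *v a1 y" "a2 (transpose R *v y) = transpose R *v a2 y"
  using equivariant[of "transpose R"] assms by simp_all

lemma A_om_equivariant:
  assumes "orthogonal_matrix R"
  shows "A_om a1 a2 \<omega> x (transpose R *v y) = transpose R *v A_om a1 a2 \<omega> (R *v x) y"
  using omega_invariant[OF assms, of x]
  by (simp add: A_om_def indicator_def equivariant_transpose[OF assms])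

text \<open>Since every \<phi> in \<open>BLC\<close> is the rotation of some \<eta>, the integrands
  for the rotated data agree almost everywhere with those for the original data, tested with \<eta>
  and evaluated at \<open>R *v x\<close>. The change of variables then returns the original
  equation.\<close>

lemma solves_K_rotated:
  assumes R: "orthogonal_matrix R" and k: "solves_K a1 a2 \<omega> W k"
  shows "solves_K a1 a2 \<omega> (transpose R *v W) (pseudo_pullback R ` k)"
  unfolding solves_K_def
proof (intro conjI ballI)
  have k_dot: "k \<in> BLC_dot"
    using k by (simp add: solves_K_def)
  then show Rk: "pseudo_pullback R ` k \<in> BLC_dot"
    by (rule BLC_dot_pseudo_pullback[OF R])
  fix \<phi> assume \<phi>: "\<phi> \<in> BLC"
  define \<eta> where "\<eta> = pseudo_pullback (transpose R) \<phi>"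
  have \<eta>: "\<eta> \<in> BLC"
    unfolding \<eta>_def using R by (intro BLC_pseudo_pullback[OF _ \<phi>]) simp
  have "\<phi> = pseudo_pullback R \<eta>"
    by (simp add: \<eta>_def pseudo_pullback_transpose[OF R])
  then have "has_weak_curl \<phi> (pullback R (weak_curl \<eta>))"
    using has_weak_curl_pseudo_pullback[OF R BLC_weak_curl(1)[OF \<eta>]] by simp
  then have w: "AE x in lebesgue. weak_curl \<phi> x = pullback R (weak_curl \<eta>) x"
    by (rule has_weak_curl_unique[OF BLC_weak_curl(1)[OF \<phi>]])
  have G: "AE x in lebesgue. class_curl (pseudo_pullback R ` k) x = pullback R (class_curl k) x"
    by (rule class_curl_pseudo_pullback[OF R k_dot])
  define F where "F x = (A_om a1 a2 \<omega> x (class_curl k x + W) - A_om a1 a2 \<omega> x W) \<bullet> weak_curl \<eta> x" for x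
  define F' where "F' x = (A_om a1 a2 \<omega> x (class_curl (pseudo_pullback R ` k) x + transpose R *v W)
      - A_om a1 a2 \<omega> x (transpose R *v W)) \<bullet> weak_curl \<phi> x" for x
  have Fm: "F \<in> borel_measurable lebesgue"
    unfolding F_def[abs_def]
    by (intro borel_measurable_inner borel_measurable_diff borel_measurable_A_om[OF continuous omega_measurable]
        borel_measurable_add class_curl_measurable(1)[OF k_dot] BLC_weak_curl(2)[OF \<eta>] borel_measurable_const)
  have F'm: "F' \<in> borel_measurable lebesgue"
    unfolding F'_def[abs_def]
    by (intro borel_measurable_inner borel_measurable_diff borel_measurable_A_om[OF continuous omega_measurable]
        borel_measurable_add class_curl_measurable(1)[OF Rk] BLC_weak_curl(2)[OF \<phi>] borel_measurable_const)
  have inner: "(transpose R *v x) \<bullet> (transpose R *v y) = x \<bullet> y" for x y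
    using orthogonal_matrix_inner(1)[of "transpose R"] R by simp
  have "AE x in lebesgue. F' x = F (R *v x)"
    using w G
  proof eventually_elim
    case (elim x)
    then show ?case
      by (simp add: F_def F'_def pullback_def A_om_equivariant[OF R] inner
          flip: matrix_vector_right_distrib matrix_vector_mult_diff_distrib)
  qed
  then have "(LINT x|lebesgue. F' x) = (LINT x|lebesgue. F (R *v x))"
    by (intro integral_cong_AE F'm borel_measurable_rotated[OF R Fm])
  also have "\<dots> = (LINT x|lebesgue. F x)"
    by (rule integral_rotated[OF R Fm])
  also have "\<dots> = - (LINT x:\<omega>|lebesgue. (a1 W - a2 W) \<bullet> weak_curl \<eta> x)"
    using k \<eta> by (simp add: solves_K_def F_def)
  also have "(LINT x:\<omega>|lebesgue. (a1 W - a2 W) \<bullet> weak_curl \<eta> x)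
      = (LINT x:\<omega>|lebesgue. (a1 (transpose R *v W) - a2 (transpose R *v W)) \<bullet> weak_curl \<phi> x)"
  proof -
    define H where "H x = indicat_real \<omega> x *\<^sub>R ((a1 W - a2 W) \<bullet> weak_curl \<eta> x)" for x
    define H' where "H' x = indicat_real \<omega> x *\<^sub>R ((a1 (transpose R *v W) - a2 (transpose R *v W)) \<bullet> weak_curl \<phi> x)" for x
    have Hm: "H \<in> borel_measurable lebesgue"
      unfolding H_def[abs_def]
      by (intro borel_measurable_scaleR borel_measurable_indicator omega_measurable borel_measurable_inner
          BLC_weak_curl(2)[OF \<eta>] borel_measurable_const)
    have H'm: "H' \<in> borel_measurable lebesgue"
      unfolding H'_def[abs_def]
      by (intro borel_measurable_scaleR borel_measurable_indicator omega_measurable borel_measurable_inner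
          BLC_weak_curl(2)[OF \<phi>] borel_measurable_const)
    have "AE x in lebesgue. H' x = H (R *v x)"
      using w
    proof eventually_elim
      case (elim x)
      then show ?case
        by (simp add: H_def H'_def pullback_def equivariant_transpose[OF R] inner indicator_def omega_invariant[OF R]
            flip: matrix_vector_mult_diff_distrib)
    qed
    then have "(LINT x|lebesgue. H' x) = (LINT x|lebesgue. H (R *v x))"
      by (intro integral_cong_AE H'm borel_measurable_rotated[OF R Hm])
    then show ?thesis
      using integral_rotated[OF R Hm] by (simp add: set_lebesgue_integral_def H_def H'_def)
  qed
  finally show "(LINT x|lebesgue. (A_om a1 a2 \<omega> x (class_curl (pseudo_pullback R ` k) x + transpose R *v W)
      - A_om a1 a2 \<omega> x (transpose R *v W)) \<bullet> weak_curl \<phi> x)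
    = - (LINT x:\<omega>|lebesgue. (a1 (transpose R *v W) - a2 (transpose R *v W)) \<bullet> weak_curl \<phi> x)"
    by (simp add: F'_def)
qed

text \<open>Existence is rotated forward by \<open>R\<close>; uniqueness is pulled back, since
  rotating a competing solution by the transpose gives a solution of the original problem.\<close>

lemma solves_K_ex1_rotated:
  assumes R: "orthogonal_matrix R" and ex1: "\<exists>!k. solves_K a1 a2 \<omega> W k"
  shows "\<exists>!k. solves_K a1 a2 \<omega> (transpose R *v W) k"
    "(THE k. solves_K a1 a2 \<omega> (transpose R *v W) k) = pseudo_pullback R ` (THE k. solves_K a1 a2 \<omega> W k)"
proof -
  define k where "k = (THE k. solves_K a1 a2 \<omega> W k)"
  have k: "solves_K a1 a2 \<omega> W k"
    unfolding k_def by (rule theI'[OF ex1])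
  have Rk: "solves_K a1 a2 \<omega> (transpose R *v W) (pseudo_pullback R ` k)"
    by (rule solves_K_rotated[OF R k])
  have uniq: "k' = pseudo_pullback R ` k" if "solves_K a1 a2 \<omega> (transpose R *v W) k'" for k'
  proof -
    have "solves_K a1 a2 \<omega> W (pseudo_pullback (transpose R) ` k')"
      using solves_K_rotated[OF _ that, of "transpose R"] R by (simp add: orthogonal_matrix_cancel[OF R])
    then have "pseudo_pullback (transpose R) ` k' = k"
      using ex1 k by blast
    moreover have "pseudo_pullback R ` pseudo_pullback (transpose R) ` k' = k'"
      by (simp add: image_image pseudo_pullback_transpose[OF R])
    ultimately show ?thesis
      by simp
  qed
  show "\<exists>!k. solves_K a1 a2 \<omega> (transpose R *v W) k"
    using Rk uniq by (rule ex1I)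
  show "(THE k. solves_K a1 a2 \<omega> (transpose R *v W) k) = pseudo_pullback R ` (THE k. solves_K a1 a2 \<omega> W k)"
    unfolding k_def[symmetric] using Rk uniq by (rule the_equality)
qed

lemma K_rotated:
  assumes R: "orthogonal_matrix R"
  shows "K a1 a2 \<omega> (transpose R *v W) = pseudo_pullback R ` K a1 a2 \<omega> W"
proof (cases "\<exists>!k. solves_K a1 a2 \<omega> W k")
  case True
  then show ?thesis
    using solves_K_ex1_rotated[OF R True] by (simp add: K_def)
next
  case False
  \<comment> \<open>If the rotated problem were uniquely solvable, rotating by the transpose would
    make the original one so. Thus both sides use the fallback, the class of zero, which every
    rotation fixes.\<close>
  have "\<not> (\<exists>!k. solves_K a1 a2 \<omega> (transpose R *v W) k)"
  proof
    assume "\<exists>!k. solves_K a1 a2 \<omega> (transpose R *v W) k"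
    from solves_K_ex1_rotated(1)[OF _ this, of "transpose R"] R False show False
      by (simp add: orthogonal_matrix_cancel[OF R])
  qed
  moreover have "pseudo_pullback R (\<lambda>x. 0) = (\<lambda>x. 0)"
    by (simp add: pseudo_pullback_def pullback_def fun_eq_iff)
  ultimately show ?thesis
    using False by (simp only: K_def if_False BLC_rel_image_pseudo_pullback[OF R])
qed

section \<open>Symmetry and linearity of \<open>dJ\<close>\<close>

lemma linear_frechet: "bounded_linear (frechet_derivative a1 (at U))" "bounded_linear (frechet_derivative a2 (at U))"
  using differentiable[of U] frechet_derivative_works has_derivative_bounded_linear by blast+

definition correction :: "real^3 \<Rightarrow> real^3 \<Rightarrow> real^3" where
  "correction U x = A_om a1 a2 \<omega> x (class_curl (K a1 a2 \<omega> U) x + U) - A_om a1 a2 \<omega> x U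
     - frechet_derivative (A_om a1 a2 \<omega> x) (at U) (class_curl (K a1 a2 \<omega> U) x)"

text \<open>The indicator is part of the field, so the integral over \<omega> becomes one over the
  whole space and the change of variables applies unaltered.\<close>

definition inner_correction :: "real^3 \<Rightarrow> real^3 \<Rightarrow> real^3" where
  "inner_correction U x = indicat_real \<omega> x *\<^sub>R
     (frechet_derivative a1 (at U) (class_curl (K a1 a2 \<omega> U) x)
      - frechet_derivative a2 (at U) (class_curl (K a1 a2 \<omega> U) x))"

lemma dJ_eq:
  "dJ a1 a2 \<omega> U P = (a1 U - a2 U) \<bullet> P
    + 1 / measure lebesgue \<omega> * (LINT x|lebesgue. correction U x \<bullet> P)
    + 1 / measure lebesgue \<omega> * (LINT x|lebesgue. inner_correction U x \<bullet> P)"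
  by (simp add: dJ_def Let_def correction_def inner_correction_def set_lebesgue_integral_def)

lemma borel_measurable_corrections:
  "correction U \<in> borel_measurable lebesgue" "inner_correction U \<in> borel_measurable lebesgue"
proof -
  define g where "g = class_curl (K a1 a2 \<omega> U)"
  have g: "g \<in> borel_measurable lebesgue"
    unfolding g_def by (rule class_curl_measurable(1)[OF K_in_BLC_dot])
  have D: "(\<lambda>x. frechet_derivative a1 (at U) (g x)) \<in> borel_measurable lebesgue"
    "(\<lambda>x. frechet_derivative a2 (at U) (g x)) \<in> borel_measurable lebesgue"
    using linear_frechet[THEN linear_continuous_on]
    by (auto intro!: measurable_compose[OF g] borel_measurable_continuous_onI)
  have w: "- \<omega> \<in> sets lebesgue"
    using sets.compl_sets[OF omega_measurable] by (simp add: Compl_eq_Diff_UNIV)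
  show "correction U \<in> borel_measurable lebesgue"
    unfolding correction_def[abs_def] g_def[symmetric] frechet_derivative_A_om[OF differentiable]
    by (intro borel_measurable_diff borel_measurable_A_om[OF continuous omega_measurable]
        borel_measurable_add borel_measurable_scaleR borel_measurable_indicator omega_measurable w D g borel_measurable_const)
  show "inner_correction U \<in> borel_measurable lebesgue"
    unfolding inner_correction_def[abs_def] g_def[symmetric]
    by (intro borel_measurable_diff borel_measurable_scaleR borel_measurable_indicator omega_measurable D)
qed

lemma corrections_rotated:
  assumes R: "orthogonal_matrix R"
  shows "AE x in lebesgue. correction (transpose R *v U) x = transpose R *v correction U (R *v x)"
    and "AE x in lebesgue. inner_correction (transpose R *v U) x = transpose R *v inner_correction U (R *v x)"
proof -
  have T: "orthogonal_matrix (transpose R)"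
    using R by simp
  have D: "frechet_derivative a1 (at (transpose R *v U)) (transpose R *v h) = transpose R *v frechet_derivative a1 (at U) h"
    "frechet_derivative a2 (at (transpose R *v U)) (transpose R *v h) = transpose R *v frechet_derivative a2 (at U) h" for h
    by (rule frechet_derivative_equivariant[OF differentiable(1) equivariant(1)[OF T]]
        frechet_derivative_equivariant[OF differentiable(2) equivariant(2)[OF T]])+
  have DA: "frechet_derivative (A_om a1 a2 \<omega> x) (at (transpose R *v U)) (transpose R *v h)
      = transpose R *v frechet_derivative (A_om a1 a2 \<omega> (R *v x)) (at U) h" for x h
    by (simp add: frechet_derivative_A_om[OF differentiable] D indicator_def omega_invariant[OF R])
  have G: "AE x in lebesgue. class_curl (K a1 a2 \<omega> (transpose R *v U)) x
      = transpose R *v class_curl (K a1 a2 \<omega> U) (R *v x)"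
    using class_curl_pseudo_pullback[OF R K_in_BLC_dot] by (simp add: K_rotated[OF R] pullback_def)
  then show "AE x in lebesgue. correction (transpose R *v U) x = transpose R *v correction U (R *v x)"
  proof eventually_elim
    case (elim x)
    then show ?case
      by (simp add: correction_def DA A_om_equivariant[OF R]
          flip: matrix_vector_right_distrib matrix_vector_mult_diff_distrib)
  qed
  show "AE x in lebesgue. inner_correction (transpose R *v U) x = transpose R *v inner_correction U (R *v x)"
    using G
  proof eventually_elim
    case (elim x)
    then show ?case
      by (simp add: inner_correction_def D indicator_def omega_invariant[OF R]
          flip: matrix_vector_mult_diff_distrib)
  qed
qed

lemma dJ_rotated:
  assumes R: "orthogonal_matrix R"
  shows "dJ a1 a2 \<omega> (transpose R *v U) (transpose R *v P) = dJ a1 a2 \<omega> U P"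
proof -
  have inner: "(transpose R *v x) \<bullet> (transpose R *v y) = x \<bullet> y" for x y
    using orthogonal_matrix_inner(1)[of "transpose R"] R by simp
  have int: "(LINT x|lebesgue. F' x \<bullet> (transpose R *v P)) = (LINT x|lebesgue. F x \<bullet> P)"
    if ae: "AE x in lebesgue. F' x = transpose R *v F (R *v x)"
      and m: "F' \<in> borel_measurable lebesgue" "F \<in> borel_measurable lebesgue" for F F'
  proof -
    have Fm: "(\<lambda>x. F x \<bullet> P) \<in> borel_measurable lebesgue"
      using m(2) by (intro borel_measurable_inner borel_measurable_const)
    have "AE x in lebesgue. F' x \<bullet> (transpose R *v P) = F (R *v x) \<bullet> P"
      using ae by eventually_elim (simp add: inner)
    then have "(LINT x|lebesgue. F' x \<bullet> (transpose R *v P)) = (LINT x|lebesgue. F (R *v x) \<bullet> P)"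
      using m by (intro integral_cong_AE borel_measurable_rotated[OF R Fm] borel_measurable_inner borel_measurable_const)
    then show ?thesis
      using integral_rotated[OF R Fm] by simp
  qed
  show ?thesis
    unfolding dJ_eq
    by (simp only: int[OF corrections_rotated(1)[OF R] borel_measurable_corrections(1) borel_measurable_corrections(1)]
        int[OF corrections_rotated(2)[OF R] borel_measurable_corrections(2) borel_measurable_corrections(2)]
        equivariant_transpose[OF R] inner flip: matrix_vector_mult_diff_distrib)
qed

text \<open>Integrability allows \<open>P\<close> to leave both integrals, after which
  \<open>dJ\<close> is the inner product of \<open>P\<close> with a fixed vector. The first
  correction is bounded by the square of the curl; the second is linear in the curl, which is
  integrable over the bounded region.\<close>

lemma linear_dJ:
  assumes c: "c \<ge> 0"
    and lip: "\<And>x y. onorm (\<lambda>h. frechet_derivative a1 (at x) h - frechet_derivative a1 (at y) h) \<le> c * norm (x - y)"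
      "\<And>x y. onorm (\<lambda>h. frechet_derivative a2 (at x) h - frechet_derivative a2 (at y) h) \<le> c * norm (x - y)"
    and bounded: "bounded \<omega>"
  shows "linear (dJ a1 a2 \<omega> U)"
proof -
  define g where "g = class_curl (K a1 a2 \<omega> U)"
  note gm = class_curl_measurable[OF K_in_BLC_dot, of a1 a2 \<omega> U, folded g_def]
  have 1: "integrable lebesgue (correction U)"
  proof (rule Bochner_Integration.integrable_bound)
    show "integrable lebesgue (\<lambda>x. c * (norm (g x))\<^sup>2)"
      using gm(2) by simp
    \<comment> \<open>At each point exactly one indicator is 1, so the correction is the
      linearization error of \<open>a1\<close> or of \<open>a2\<close>, and both have the same
      bound.\<close>
    have "norm (correction U x) \<le> c * (norm (g x))\<^sup>2" for x
      using linearization_error[OF differentiable(1) c lip(1), of "g x" U]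
        linearization_error[OF differentiable(2) c lip(2), of "g x" U]
      by (simp add: correction_def g_def[symmetric] frechet_derivative_A_om[OF differentiable] A_om_def indicator_def)
    then show "AE x in lebesgue. norm (correction U x) \<le> norm (c * (norm (g x))\<^sup>2)"
      using c by simp
  qed (rule borel_measurable_corrections)
  have 2: "integrable lebesgue (inner_correction U)"
  proof -
    have "set_integrable lebesgue (closure \<omega>) g"
      using gm(3) bounded by (simp add: locally_integrable_def)
    then have "set_integrable lebesgue \<omega> g"
      by (rule set_integrable_subset) (auto simp: omega_measurable closure_subset)
    then have "integrable lebesgue (\<lambda>x. frechet_derivative a1 (at U) (indicat_real \<omega> x *\<^sub>R g x)
        - frechet_derivative a2 (at U) (indicat_real \<omega> x *\<^sub>R g x))"
      unfolding set_integrable_def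
      by (intro Bochner_Integration.integrable_diff integrable_bounded_linear[OF linear_frechet(1)]
          integrable_bounded_linear[OF linear_frechet(2)])
    then show ?thesis
      by (simp add: inner_correction_def[abs_def] g_def linear_cmul[OF bounded_linear.linear[OF linear_frechet(1)]]
          linear_cmul[OF bounded_linear.linear[OF linear_frechet(2)]] scaleR_diff_right)
  qed
  have "dJ a1 a2 \<omega> U = (\<lambda>P. (a1 U - a2 U + (1 / measure lebesgue \<omega>) *\<^sub>R
      ((LINT x|lebesgue. correction U x) + (LINT x|lebesgue. inner_correction U x))) \<bullet> P)"
    using 1 2 by (simp add: dJ_eq fun_eq_iff inner_add_left distrib_left)
  then show ?thesis
    by (simp add: bounded_linear.linear bounded_linear_inner_right)
qed

end

theorem theorem3:
  fixes a1 a2 :: "real^3 \<Rightarrow> real^3" and \<omega> :: "(real^3) set" and c1 c2 c3 :: real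
  assumes C1: "\<And>a. a \<in> {a1, a2} \<Longrightarrow> Ck 1 a"
    and pos: "c1 > 0" "c2 > 0" "c3 > 0"
    and monotone: "\<And>a x y. a \<in> {a1, a2} \<Longrightarrow> (a x - a y) \<bullet> (x - y) \<ge> c1 * (norm (x - y))\<^sup>2"
    and Lipschitz: "\<And>a x y. a \<in> {a1, a2} \<Longrightarrow> norm (a x - a y) \<le> c2 * norm (x - y)"
    and Lipschitz_deriv: "\<And>a x y. a \<in> {a1, a2} \<Longrightarrow>
           onorm (\<lambda>h. frechet_derivative a (at x) h - frechet_derivative a (at y) h)
             \<le> c3 * norm (x - y)"
    and equivariant: "\<And>a R y. a \<in> {a1, a2} \<Longrightarrow> orthogonal_matrix R \<Longrightarrow> a (R *v y) = R *v a y"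
    and unit_ball: "\<omega> = ball 0 1"
  shows "(\<forall>U. linear (dJ a1 a2 \<omega> U)) \<and>
    (\<forall>U P R. orthogonal_matrix R \<longrightarrow>
           dJ a1 a2 \<omega> (transpose R *v U) (transpose R *v P) = dJ a1 a2 \<omega> U P) \<and>
    (\<forall>U P RU RP c. orthogonal_matrix RU \<and> orthogonal_matrix RP \<and>
           U = norm U *\<^sub>R (RU *v axis 1 1) \<and> P = norm P *\<^sub>R (RP *v axis 1 1) \<and>
           c = norm P *\<^sub>R (transpose RU *v (RP *v axis 1 1)) \<longrightarrow>
           dJ a1 a2 \<omega> U P =
             c $ 1 * dJ a1 a2 \<omega> (norm U *\<^sub>R axis 1 1) (axis 1 1)
           + c $ 2 * dJ a1 a2 \<omega> (norm U *\<^sub>R axis 1 1) (axis 2 1)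
           + c $ 3 * dJ a1 a2 \<omega> (norm U *\<^sub>R axis 1 1) (axis 3 1))"
proof -
  interpret isotropic_pair a1 a2 \<omega>
  proof
    show "R *v x \<in> \<omega> \<longleftrightarrow> x \<in> \<omega>" if "orthogonal_matrix R" for R :: "real^3^3" and x
      using orthogonal_matrix_inner(3)[OF that] by (simp add: unit_ball)
  qed (use C1 equivariant in \<open>auto simp: unit_ball\<close>)
  have lin: "linear (dJ a1 a2 \<omega> U)" for U
    using pos(3) Lipschitz_deriv by (intro linear_dJ[of c3]) (auto simp: unit_ball)
  have "dJ a1 a2 \<omega> U P =
             c $ 1 * dJ a1 a2 \<omega> (norm U *\<^sub>R axis 1 1) (axis 1 1)
           + c $ 2 * dJ a1 a2 \<omega> (norm U *\<^sub>R axis 1 1) (axis 2 1)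
           + c $ 3 * dJ a1 a2 \<omega> (norm U *\<^sub>R axis 1 1) (axis 3 1)"
    if RU: "orthogonal_matrix RU" and U: "U = norm U *\<^sub>R (RU *v axis 1 1)" and P: "P = norm P *\<^sub>R (RP *v axis 1 1)"
      and c: "c = norm P *\<^sub>R (transpose RU *v (RP *v axis 1 1))" for U P :: "real^3" and RU RP :: "real^3^3" and c
  proof -
    \<comment> \<open>The transpose of \<open>RU\<close> sends \<open>U\<close> to a multiple of the
      first basis vector and \<open>P\<close> to the coefficient vector \<open>c\<close>; expanding
      \<open>c\<close> in the basis and using linearity finishes the proof.\<close>
    have "transpose RU *v U = transpose RU *v (norm U *\<^sub>R (RU *v axis 1 1))"
      using U by simp
    also have "\<dots> = norm U *\<^sub>R axis 1 1"
      by (simp add: matrix_vector_mult_scaleR orthogonal_matrix_cancel[OF RU])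
    finally have 1: "transpose RU *v U = norm U *\<^sub>R axis 1 1" .
    have "transpose RU *v P = transpose RU *v (norm P *\<^sub>R (RP *v axis 1 1))"
      using P by simp
    also have "\<dots> = c"
      by (simp add: c matrix_vector_mult_scaleR)
    also have "c = c $ 1 *\<^sub>R axis 1 1 + c $ 2 *\<^sub>R axis 2 1 + c $ 3 *\<^sub>R axis 3 1"
      using basis_expansion[of c] by (simp add: sum_3 scalar_mult_eq_scaleR)
    finally show ?thesis
      using dJ_rotated[OF RU, of U P] by (simp add: 1 linear_add[OF lin] linear_cmul[OF lin])
  qed
  then show ?thesis
    using lin dJ_rotated by blast
qed

end
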